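(* Let $(G,\sigma)$ be a signed graph where $G$ is a near triangulation with outer facial cycle $C=v_1v_2\cdots v_k$, and let $e=v_1v_2$. Then $G-e$ has a $\sigma$-nice orientation, i.e., an orientation $D$ of $G-e$ such that (1) $|\sigma EE(D)|\neq|\sigma OE(D)|$, and (2) $v_1$ and $v_2$ have outdegree $0$ in $D$, $v_i$ has outdegree at most $2$ for each $i\in\{3,\dots,k\}$, and every interior vertex (vertex not on $C$) has outdegree at most $4$.
   Context: A signed graph $(G,\sigma)$ consists of a finite simple graph $G$ and $\sigma\colon E(G)\to\{+1,-1\}$; edges with $\sigma=+1$ are positive. A near triangulation is a plane graph whose outer face is bounded by a cycle (the outer facial cycle) and all of whose inner faces are bounded by triangles. For an orientation $D$ of a subgraph $G'$ of $G$ (here $G'=G-e$), an Eulerian subdigraph of $D$ is a spanning subdigraph (not necessarily connected, possibly edgeless) in which every vertex has indegree equal to outdegree; it is $\sigma$-even (resp. $\sigma$-odd) if it contains an even (resp. odd) number of edges $f$ with $\sigma(f)=+1$. $\sigma EE(D)$ and $\sigma OE(D)$ denote the sets of $\sigma$-even and $\sigma$-odd Eulerian subdigraphs of $D$. *)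

theory Defs
  imports
    "Graph_Theory.Digraph_Component"
    "Graph_Theory.Pair_Digraph"
    "HOL-Analysis.Analysis"
begin

(* Graph_Theory also defines a constant of this name; keep the topological one. *)
hide_const (open) Digraph_Component.connected

section \<open>Signed graphs and cycles\<close>

locale simple_graph =
  fixes V :: "'a set" and E :: "'a set set"
  assumes finite_vertices: "finite V"
    and edge_subset: "e \<in> E \<Longrightarrow> e \<subseteq> V"
    and edge_card: "e \<in> E \<Longrightarrow> card e = 2"

locale signed_graph = simple_graph V E for V :: "'a set" and E +
  fixes \<sigma> :: "'a set \<Rightarrow> int"
  assumes sign: "e \<in> E \<Longrightarrow> \<sigma> e \<in> {1, -1}"

definition cycle_edges :: "'a list \<Rightarrow> 'a set set" where
  "cycle_edges C = {{C ! i, C ! (Suc i mod length C)} | i. i < length C}"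

definition is_cycle :: "'a set set \<Rightarrow> 'a list \<Rightarrow> bool" where
  "is_cycle E C \<longleftrightarrow> distinct C \<and> 3 \<le> length C \<and> cycle_edges C \<subseteq> E"

section \<open>Plane graphs\<close>

text \<open>
  The vertices are points of the plane, which is identified with the complex numbers, and
  \<open>\<gamma> e\<close> parametrizes the arc drawn for the edge \<open>e\<close>. The last two axioms say that the interior
  of an edge contains no vertex and no point of another edge.
\<close>

locale plane_graph = simple_graph V E for V :: "complex set" and E +
  fixes \<gamma> :: "complex set \<Rightarrow> real \<Rightarrow> complex"
  assumes edge_arc: "e \<in> E \<Longrightarrow> arc (\<gamma> e)"
    and edge_ends: "e \<in> E \<Longrightarrow> {pathstart (\<gamma> e), pathfinish (\<gamma> e)} = e"
    and edge_vertices: "e \<in> E \<Longrightarrow> path_image (\<gamma> e) \<inter> V = e"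
    and edges_disjoint:
      "e \<in> E \<Longrightarrow> f \<in> E \<Longrightarrow> e \<noteq> f \<Longrightarrow> path_image (\<gamma> e) \<inter> path_image (\<gamma> f) \<subseteq> e \<inter> f"

definition plane_points :: "complex set \<Rightarrow> complex set set \<Rightarrow> (complex set \<Rightarrow> real \<Rightarrow> complex) \<Rightarrow> complex set" where
  "plane_points V E \<gamma> = V \<union> (\<Union>e\<in>E. path_image (\<gamma> e))"

definition faces :: "complex set \<Rightarrow> complex set set \<Rightarrow> (complex set \<Rightarrow> real \<Rightarrow> complex) \<Rightarrow> complex set set" where
  "faces V E \<gamma> = components (- plane_points V E \<gamma>)"

definition bounded_by_cycle ::
    "complex set set \<Rightarrow> (complex set \<Rightarrow> real \<Rightarrow> complex) \<Rightarrow> complex set \<Rightarrow> complex list \<Rightarrow> bool" where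
  "bounded_by_cycle E \<gamma> F C \<longleftrightarrow>
     is_cycle E C \<and> frontier F = plane_points (set C) (cycle_edges C) \<gamma>"

text \<open>
  The outer face is the unbounded one (unique, since a plane graph is a compact subset of the
  plane), the inner faces are the bounded ones.
\<close>

locale near_triangulation = plane_graph V E \<gamma> for V E \<gamma> +
  fixes C :: "complex list"
  assumes outer_cycle: "F \<in> faces V E \<gamma> \<Longrightarrow> \<not> bounded F \<Longrightarrow> bounded_by_cycle E \<gamma> F C"
    and inner_triangle: "F \<in> faces V E \<gamma> \<Longrightarrow> bounded F \<Longrightarrow>
      \<exists>T. length T = 3 \<and> bounded_by_cycle E \<gamma> F T"

section \<open>Orientations and Eulerian subdigraphs\<close>

definition underlying_edge :: "'a \<times> 'a \<Rightarrow> 'a set" where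
  "underlying_edge a = {fst a, snd a}"

definition orientation_of :: "'a pair_pre_digraph \<Rightarrow> 'a set \<Rightarrow> 'a set set \<Rightarrow> bool" where
  "orientation_of D V E \<longleftrightarrow>
     pverts D = V \<and> underlying_edge ` parcs D \<subseteq> E \<and> (\<forall>e\<in>E. \<exists>!a. a \<in> parcs D \<and> underlying_edge a = e)"

definition eulerian_subdigraphs :: "'a pair_pre_digraph \<Rightarrow> 'a pair_pre_digraph set" where
  "eulerian_subdigraphs D =
     {H :: 'a pair_pre_digraph. spanning (with_proj H) (with_proj D) \<and>
        (\<forall>v\<in>pverts D. in_degree (with_proj H) v = out_degree (with_proj H) v)}"

definition positive_arcs :: "('a set \<Rightarrow> int) \<Rightarrow> 'a pair_pre_digraph \<Rightarrow> ('a \<times> 'a) set" where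
  "positive_arcs \<sigma> H = {a \<in> parcs H. \<sigma> (underlying_edge a) = 1}"

definition sigma_EE :: "('a set \<Rightarrow> int) \<Rightarrow> 'a pair_pre_digraph \<Rightarrow> 'a pair_pre_digraph set" where
  "sigma_EE \<sigma> D = {H \<in> eulerian_subdigraphs D. even (card (positive_arcs \<sigma> H))}"

definition sigma_OE :: "('a set \<Rightarrow> int) \<Rightarrow> 'a pair_pre_digraph \<Rightarrow> 'a pair_pre_digraph set" where
  "sigma_OE \<sigma> D = {H \<in> eulerian_subdigraphs D. odd (card (positive_arcs \<sigma> H))}"

text \<open>
  The cycle \<open>v\<^sub>1 v\<^sub>2 \<dots> v\<^sub>k\<close> is the list \<open>C\<close>, so that \<open>v\<^sub>i\<close> is \<open>C ! (i - 1)\<close>.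
\<close>

definition sigma_nice ::
    "'a set \<Rightarrow> ('a set \<Rightarrow> int) \<Rightarrow> 'a list \<Rightarrow> 'a pair_pre_digraph \<Rightarrow> bool" where
  "sigma_nice V \<sigma> C D \<longleftrightarrow>
     card (sigma_EE \<sigma> D) \<noteq> card (sigma_OE \<sigma> D) \<and>
     out_degree (with_proj D) (C ! 0) = 0 \<and>
     out_degree (with_proj D) (C ! 1) = 0 \<and>
     (\<forall>i\<in>{3..length C}. out_degree (with_proj D) (C ! (i - 1)) \<le> 2) \<and>
     (\<forall>v\<in>V - set C. out_degree (with_proj D) v \<le> 4)"

end

theory Submission
  imports Defs
begin

text \<open>
  Reversing the arcs of an Eulerian subdigraph of \<open>D\<close> gives an orientation with the same
  outdegrees, so \<open>|\<sigma>EE(D)| - |\<sigma>OE(D)|\<close> is, up to sign, the coefficient of the outdegree monomial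
  of \<open>D\<close> in a product over the edges \<open>uv\<close> of the factors \<open>x\<^sub>u - x\<^sub>v\<close> (positive edges) and
  \<open>x\<^sub>u + x\<^sub>v\<close> (the others). A nonvanishing coefficient with the required exponents is found, by
  induction on the number of edges, for the part of the graph inside an arbitrary cycle and each
  edge \<open>v\<^sub>1v\<^sub>2\<close> of that cycle. If there is a chord at the last vertex \<open>v\<^sub>k\<close>, it cuts the disc into
  two, and the coefficients multiply. Otherwise \<open>v\<^sub>k\<close> is deleted: its neighbours are \<open>v\<^sub>1\<close>,
  \<open>v\<^sub>k\<^sub>-\<^sub>1\<close> and the vertices \<open>u\<close> of a path on the new outer cycle. If \<open>m\<close> is a good monomial for the
  smaller disc, then \<open>m x\<^sub>k\<^sup>2 \<Prod>u\<close> is good for the larger one unless its coefficient vanishes, in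
  which case some \<open>m u / x\<^sub>k\<^sub>-\<^sub>1\<close> has a nonzero coefficient, and then so has \<open>m x\<^sub>k u \<Prod>u\<close>.
\<close>

section \<open>Coefficients of products over edges\<close>

text \<open>The obstacle is cancellation: the right degrees do not make a coefficient nonzero, so
  the monomial used at the deleted vertex cannot be fixed in advance. Write v, a, b for its last,
  first and next to last cycle vertex. As a stays a sink, the edge va has tail v. With tail v at vb,
  every edge vu has tail u, and the term is a nonzero multiple of the coefficient of m. With tail b,
  exactly one vu has tail v, and the term combines the coefficients of the monomials m u / b. If
  both terms cancel, one of the latter is nonzero; in it b has lost a factor and can be the tail of
  vb without exceeding its bound. The bounds 2 and 4 fit this: each u lies on the smaller cycle with
  exponent at most 2, becomes interior, gains 1 from its edge to v and at most 1 more as the chosen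
  u. Exponent 0 at both ends of the root edge makes the halves at a chord independent, because the
  chord is the root edge of one half. The drawing never changes: smaller discs are parts of the
  fixed plane graph inside other cycles, so their faces are still triangles.\<close>

text \<open>
  The coefficient of the monomial \<open>M\<close> in the product over \<open>e \<in> E\<close> of the linear forms
  \<open>\<Sum>x\<in>e. s e x * X x\<close>.
\<close>

definition orient_coeff :: "('a set \<Rightarrow> 'a \<Rightarrow> int) \<Rightarrow> 'a set set \<Rightarrow> 'a multiset \<Rightarrow> int" where
  "orient_coeff s E M =
     (\<Sum>f \<in> (\<Pi>\<^sub>E e\<in>E. e). if image_mset f (mset_set E) = M then \<Prod>e\<in>E. s e (f e) else 0)"

lemma orient_coeff_empty: "orient_coeff s {} M = (if M = {#} then 1 else 0)"
  by (auto simp: orient_coeff_def)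

text \<open>Expansion along one edge: a tail choice on \<open>insert e E\<close> is a tail of
  \<open>e\<close> together with a tail choice on \<open>E\<close>. The guard
  \<open>x \<in># M\<close> matters because multiset subtraction truncates: \<open>M - {#x#}\<close>
  is \<open>M\<close> when \<open>x\<close> is absent.\<close>

lemma orient_coeff_insert:
  assumes "finite E" "e \<notin> E"
  shows "orient_coeff s (insert e E) M =
    (\<Sum>x\<in>e. if x \<in># M then s e x * orient_coeff s E (M - {#x#}) else 0)"
proof -
  let ?P = "\<Pi>\<^sub>E e\<in>E. e"
  let ?h = "\<lambda>(y, g). g(e := y)"
  have "orient_coeff s (insert e E) M =
    (\<Sum>f \<in> ?h ` (e \<times> ?P). if image_mset f (mset_set (insert e E)) = M
       then \<Prod>e\<in>insert e E. s e (f e) else 0)"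
    unfolding orient_coeff_def PiE_insert_eq ..
  also have "\<dots> = (\<Sum>(y, g) \<in> e \<times> ?P. if image_mset (g(e := y)) (mset_set (insert e E)) = M
       then \<Prod>e'\<in>insert e E. s e' ((g(e := y)) e') else 0)"
    using inj_combinator[OF assms(2), of "\<lambda>e. e"] 
    by (subst sum.reindex) (auto simp: case_prod_unfold)
  also have "\<dots> = (\<Sum>y\<in>e. \<Sum>g\<in>?P. if image_mset (g(e := y)) (mset_set (insert e E)) = M
       then \<Prod>e'\<in>insert e E. s e' ((g(e := y)) e') else 0)"
    by (rule sum.cartesian_product[symmetric])
  also have "\<dots> = (\<Sum>x\<in>e. if x \<in># M then s e x * orient_coeff s E (M - {#x#}) else 0)"
  proof (rule sum.cong[OF refl])
    fix x assume "x \<in> e"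
    have img: "image_mset (g(e := x)) (mset_set (insert e E)) = add_mset x (image_mset g (mset_set E))"
      for g
    proof -
      have "image_mset (g(e := x)) (mset_set E) = image_mset g (mset_set E)"
        using assms by (intro image_mset_cong) auto
      then show ?thesis using assms by simp
    qed
    have prd: "(\<Prod>e'\<in>insert e E. s e' ((g(e := x)) e')) = s e x * (\<Prod>e'\<in>E. s e' (g e'))" for g
    proof -
      have "(\<Prod>e'\<in>E. s e' ((g(e := x)) e')) = (\<Prod>e'\<in>E. s e' (g e'))"
        using assms by (intro prod.cong) auto
      then show ?thesis using assms by simp
    qed
    show "(\<Sum>g\<in>?P. if image_mset (g(e := x)) (mset_set (insert e E)) = M
       then \<Prod>e'\<in>insert e E. s e' ((g(e := x)) e') else 0) =
      (if x \<in># M then s e x * orient_coeff s E (M - {#x#}) else 0)"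
    proof (cases "x \<in># M")
      case True
      then have eq: "add_mset x N = M \<longleftrightarrow> N = M - {#x#}" for N
        by auto
      show ?thesis
        unfolding img prd eq orient_coeff_def using True
        by (simp add: sum_distrib_left if_distrib cong: if_cong)
    next
      case False
      then have "add_mset x N \<noteq> M" for N by auto
      then show ?thesis
        unfolding img using False by simp
    qed
  qed
  finally show ?thesis .
qed

lemma orient_coeff_insert_doubleton:
  assumes "finite E" "{x, y} \<notin> E" "x \<noteq> y"
  shows "orient_coeff s (insert {x, y} E) M =
    (if x \<in># M then s {x, y} x * orient_coeff s E (M - {#x#}) else 0) +
    (if y \<in># M then s {x, y} y * orient_coeff s E (M - {#y#}) else 0)"
  using assms by (simp add: orient_coeff_insert)

lemma orient_coeff_nonzeroE:
  assumes "orient_coeff s E M \<noteq> 0"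
  obtains f where "f \<in> (\<Pi>\<^sub>E e\<in>E. e)" "image_mset f (mset_set E) = M"
proof -
  obtain f where "f \<in> (\<Pi>\<^sub>E e\<in>E. e)" "(if image_mset f (mset_set E) = M then \<Prod>e\<in>E. s e (f e) else 0) \<noteq> 0"
    using assms unfolding orient_coeff_def by (rule sum.not_neutral_contains_not_neutral)
  then show thesis by (intro that) (auto split: if_splits)
qed

lemma orient_coeff_nonzero:
  assumes "orient_coeff s E M \<noteq> 0" 
  shows "size M = card E" and "set_mset M \<subseteq> \<Union>E"
proof -
  obtain f where f: "f \<in> (\<Pi>\<^sub>E e\<in>E. e)" "image_mset f (mset_set E) = M"
    using assms by (rule orient_coeff_nonzeroE)
  \<comment> \<open>For infinite \<open>E\<close> both sides are 0, since then
    \<open>mset_set E = {#}\<close> and \<open>card E = 0\<close>.\<close>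
  have "finite E \<or> infinite E" by simp
  with f(2) show "size M = card E" by auto
  show "set_mset M \<subseteq> \<Union>E"
  proof
    fix x assume "x \<in># M"
    then obtain e where "e \<in># mset_set E" "x = f e" using f(2) by auto
    moreover have "e \<in> E" using \<open>e \<in># mset_set E\<close> by (cases "finite E") auto
    ultimately show "x \<in> \<Union>E" using f(1) by auto
  qed
qed

text \<open>
  If no edge of \<open>E1\<close> meets the support of \<open>M2\<close>, all tails counted by \<open>M2\<close> come from \<open>E2\<close>, and
  there are just enough of them.
\<close>

lemma orient_coeff_union:
  assumes "finite E1" "finite E2" "E1 \<inter> E2 = {}"
    and "\<And>e. e \<in> E1 \<Longrightarrow> e \<inter> set_mset M2 = {}" and "size M2 = card E2"
  shows "orient_coeff s (E1 \<union> E2) (M1 + M2) = orient_coeff s E1 M1 * orient_coeff s E2 M2"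
  using assms
proof (induction E1 arbitrary: M1)
  case empty
  show ?case
  proof (cases "M1 = {#}")
    case False
    \<comment> \<open>Comparison of degrees: the product over \<open>E2\<close> has degree
      \<open>card E2\<close>, which \<open>M2\<close> alone exhausts.\<close>
    then have "size (M1 + M2) \<noteq> card E2" using empty by simp
    then have "orient_coeff s E2 (M1 + M2) = 0" using orient_coeff_nonzero(1) by blast
    then show ?thesis using False by (simp add: orient_coeff_empty)
  qed (simp add: orient_coeff_empty)
next
  case (insert e E1)
  have IH: "orient_coeff s (E1 \<union> E2) (M + M2) = orient_coeff s E1 M * orient_coeff s E2 M2" for M
    using insert.prems by (intro insert.IH) auto
  have "orient_coeff s (insert e E1 \<union> E2) (M1 + M2) =
     (\<Sum>x\<in>e. if x \<in># M1 + M2 then s e x * orient_coeff s (E1 \<union> E2) (M1 + M2 - {#x#}) else 0)"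
    using insert.hyps insert.prems by (simp add: orient_coeff_insert)
  also have "\<dots> = (\<Sum>x\<in>e. (if x \<in># M1 then s e x * orient_coeff s E1 (M1 - {#x#}) else 0)
      * orient_coeff s E2 M2)"
  proof (rule sum.cong[OF refl])
    fix x assume "x \<in> e"
    then have "x \<notin># M2" using insert.prems(3)[of e] by auto
    show "(if x \<in># M1 + M2 then s e x * orient_coeff s (E1 \<union> E2) (M1 + M2 - {#x#}) else 0) =
      (if x \<in># M1 then s e x * orient_coeff s E1 (M1 - {#x#}) else 0) * orient_coeff s E2 M2"
    proof (cases "x \<in># M1")
      case True
      then have "M1 + M2 - {#x#} = (M1 - {#x#}) + M2"
        by (simp add: multiset_eq_iff)
      then have "orient_coeff s (E1 \<union> E2) (M1 + M2 - {#x#}) =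
          orient_coeff s E1 (M1 - {#x#}) * orient_coeff s E2 M2"
        using IH by metis
      with True show ?thesis by simp
    qed (use \<open>x \<notin># M2\<close> in simp)
  qed
  also have "\<dots> = orient_coeff s (insert e E1) M1 * orient_coeff s E2 M2"
    using insert.hyps by (simp add: orient_coeff_insert sum_distrib_right)
  finally show ?case .
qed

text \<open>As \<open>v\<close> does not occur in the monomial, each edge from \<open>v\<close> to
  some \<open>u\<close> must have tail \<open>u\<close>. This uses up exactly
  \<open>mset_set U\<close>, and the coefficient only picks up a nonzero factor.\<close>

lemma orient_coeff_star:
  assumes "finite U" "v \<notin> U" "finite E" "v \<notin> \<Union>E" "v \<notin># M"
    and "\<And>e x. s e x \<noteq> 0"
  shows "orient_coeff s (E \<union> (\<lambda>u. {v, u}) ` U) (M + mset_set U) \<noteq> 0 \<longleftrightarrow> orient_coeff s E M \<noteq> 0"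
  using assms(1,2)
proof (induction U)
  case (insert u U)
  have "{v, u} \<notin> E \<union> (\<lambda>u. {v, u}) ` U"
    using assms(4) insert.hyps insert.prems by (auto simp: doubleton_eq_iff)
  then have "orient_coeff s (insert {v, u} (E \<union> (\<lambda>u. {v, u}) ` U)) (M + mset_set (insert u U)) =
     s {v, u} u * orient_coeff s (E \<union> (\<lambda>u. {v, u}) ` U) (M + mset_set U)"
    using insert.hyps insert.prems assms(3-5)
    by (subst orient_coeff_insert_doubleton) auto
  then show ?case using insert assms(6) by simp
qed simp

text \<open>The single \<open>v\<close> in the monomial cannot come from \<open>E\<close>, so
  exactly one star edge has tail \<open>v\<close>. The other end \<open>u\<close> of that edge is
  then still owed one occurrence, which \<open>E\<close> has to supply. The coefficient is a
  combination of these contributions, so one of them is nonzero.\<close>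

lemma orient_coeff_star_once:
  assumes "finite U" "v \<notin> U" "finite E" "v \<notin> \<Union>E" "v \<notin># M"
    and nz: "\<And>e x. s e x \<noteq> 0"
    and "orient_coeff s (E \<union> (\<lambda>u. {v, u}) ` U) (add_mset v (M + mset_set U)) \<noteq> 0"
  obtains u where "u \<in> U" "orient_coeff s E (add_mset u M) \<noteq> 0"
proof -
  have "\<exists>u\<in>U. orient_coeff s E (add_mset u M) \<noteq> 0"
    using assms(1,2,7)
  proof (induction U)
    case empty
    then have "v \<in> \<Union>E" using orient_coeff_nonzero(2)[of s E "add_mset v M"] by auto
    then show ?case using assms(4) by blast
  next
    case (insert u U)
    let ?E = "E \<union> (\<lambda>u. {v, u}) ` U"
    have "{v, u} \<notin> ?E"
      using assms(4) insert.hyps insert.prems by (auto simp: doubleton_eq_iff)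
    then have "orient_coeff s (insert {v, u} ?E) (add_mset v (M + mset_set (insert u U))) =
       s {v, u} v * orient_coeff s ?E (add_mset u M + mset_set U) +
       s {v, u} u * orient_coeff s ?E (add_mset v (M + mset_set U))"
      using insert.hyps insert.prems(1) assms(3)
      by (subst orient_coeff_insert_doubleton) (auto simp: add_mset_commute)
    then have "orient_coeff s ?E (add_mset u M + mset_set U) \<noteq> 0 \<or>
        orient_coeff s ?E (add_mset v (M + mset_set U)) \<noteq> 0"
      using insert.prems(2) by auto
    then show ?case
    proof
      assume "orient_coeff s ?E (add_mset u M + mset_set U) \<noteq> 0"
      then have "orient_coeff s E (add_mset u M) \<noteq> 0"
        using orient_coeff_star[of U v E "add_mset u M" s] insert assms by auto
      then show ?thesis by blast
    qed (use insert in auto)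
  qed
  then show thesis using that by blast
qed

text \<open>
  The vertex \<open>v\<close> is added with neighbours \<open>a\<close>, \<open>b\<close> and \<open>U\<close>, where \<open>a\<close> is to stay a sink. The tail
  multiset \<open>M + U + 2v\<close> arises from \<open>M\<close> by giving both \<open>va\<close> and \<open>vb\<close> the tail \<open>v\<close>. If its
  coefficient vanishes, the contribution of \<open>M\<close> is cancelled by that of some \<open>M - b + u\<close>, which
  leaves room for the tail \<open>b\<close> at \<open>vb\<close>.
\<close>

lemma orient_coeff_add_vertex:
  assumes "finite U" "v \<notin> U" "finite E" "v \<notin> \<Union>E" "orient_coeff s E M \<noteq> 0"
    and "a \<notin> U" "b \<notin> U" "a \<noteq> b" "a \<noteq> v" "b \<noteq> v" "a \<notin># M"
    and nz: "\<And>e x. s e x \<noteq> 0"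
  defines "E' \<equiv> insert {v, a} (insert {v, b} (E \<union> (\<lambda>u. {v, u}) ` U))"
  obtains
    (double) "orient_coeff s E' (add_mset v (add_mset v (M + mset_set U))) \<noteq> 0"
  | (single) u where "b \<in># M" "u \<in> U" 
      "orient_coeff s E' (add_mset v (add_mset u (M + mset_set U))) \<noteq> 0"
proof -
  let ?S = "E \<union> (\<lambda>u. {v, u}) ` U"
  have vM: "v \<notin># M" using orient_coeff_nonzero(2)[OF assms(5)] assms(4) by blast
  have new: "{v, b} \<notin> ?S" "{v, a} \<notin> insert {v, b} ?S" "finite ?S"
    using assms(1-10) by (auto simp: doubleton_eq_iff)
  \<comment> \<open>The vertex \<open>a\<close> is missing from all monomials considered, so the
    edge \<open>{v, a}\<close> can only have tail \<open>v\<close>.\<close>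
  have forced: "orient_coeff s E' (add_mset v N) = s {v, a} v * orient_coeff s (insert {v, b} ?S) N"
    if "a \<notin># N" for N
    unfolding E'_def using new assms that by (subst orient_coeff_insert_doubleton) auto
  show thesis
  proof (cases "orient_coeff s (insert {v, b} ?S) (add_mset v (M + mset_set U)) = 0")
    case False
    then have "orient_coeff s E' (add_mset v (add_mset v (M + mset_set U))) \<noteq> 0"
      using nz assms by (subst forced) auto
    then show thesis by (rule double)
  next
    case True
    have "orient_coeff s ?S (M + mset_set U) \<noteq> 0"
      using orient_coeff_star[OF assms(1-4) vM nz] assms(5) by simp
    \<comment> \<open>The summand with tail \<open>v\<close> at \<open>{v, b}\<close> is nonzero, so
      the vanishing of the total forces the summand with tail \<open>b\<close> to be nonzero
      too.\<close>
    with True have bM: "b \<in># M" and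
      "orient_coeff s ?S (add_mset v (M + mset_set U) - {#b#}) \<noteq> 0"
      using new nz assms(1,2,7,10) by (auto simp: orient_coeff_insert_doubleton split: if_splits)
    moreover obtain M' where M': "M = add_mset b M'" using bM by (meson mset_add)
    ultimately have once: "orient_coeff s ?S (add_mset v (M' + mset_set U)) \<noteq> 0"
      using assms(10) by (simp add: add_mset_commute)
    have "v \<notin># M'" using vM M' by simp
    then obtain u where u: "u \<in> U" "orient_coeff s E (add_mset u M') \<noteq> 0"
      by (rule orient_coeff_star_once[OF assms(1-4) _ nz once])
    have "orient_coeff s ?S (add_mset u M' + mset_set U) \<noteq> 0"
      using orient_coeff_star[OF assms(1-4), of "add_mset u M'" s] nz u vM M' assms(2) by auto
    \<comment> \<open>With \<open>v\<close> absent, \<open>{v, b}\<close> must have tail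
      \<open>b\<close>: the \<open>b\<close> split off from \<open>M\<close> is returned, and there
      is no second term that could cancel.\<close>
    moreover have "v \<notin># add_mset u (add_mset b (M' + mset_set U))"
      using vM M' u assms by auto
    ultimately have "orient_coeff s (insert {v, b} ?S) (add_mset u (M + mset_set U)) \<noteq> 0"
      using new assms(10) nz
      by (subst orient_coeff_insert_doubleton) (auto simp: M' add_mset_commute)
    then have "orient_coeff s E' (add_mset v (add_mset u (M + mset_set U))) \<noteq> 0"
      using nz assms u by (subst forced) auto
    then show thesis using single bM u by blast
  qed
qed

section \<open>Orientations from coefficients\<close>

text \<open>
  Factors \<open>x - y\<close> for positive and \<open>x + y\<close> for other edges; \<open>SOME\<close> only fixes the irrelevant
  global sign.
\<close>

definition tail_sign :: "('a set \<Rightarrow> int) \<Rightarrow> 'a set \<Rightarrow> 'a \<Rightarrow> int" where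
  "tail_sign \<sigma> e x = (if \<sigma> e = 1 \<and> x \<noteq> (SOME y. y \<in> e) then -1 else 1)"

lemma tail_sign_nonzero: "tail_sign \<sigma> e x \<noteq> 0"
  by (simp add: tail_sign_def)

text \<open>The arbitrary reference end cancels in the product. Hence the sign of one tail choice
  relative to another counts the positive edges on which they differ.\<close>

lemma tail_sign_mult:
  assumes "card e = 2" "x \<in> e" "y \<in> e"
  shows "tail_sign \<sigma> e x * tail_sign \<sigma> e y = (if x \<noteq> y \<and> \<sigma> e = 1 then -1 else 1)"
proof -
  obtain a b where e: "e = {a, b}" "a \<noteq> b" using assms(1) by (auto simp: card_2_iff)
  have "(SOME y. y \<in> e) \<in> e" using assms(2) by (rule someI)
  then show ?thesis using assms e by (auto simp: tail_sign_def)
qed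

section \<open>Tail choices as orientations, their differences as subdigraphs\<close>

definition tail_orientation :: "'a set \<Rightarrow> 'a set set \<Rightarrow> ('a set \<Rightarrow> 'a) \<Rightarrow> 'a pair_pre_digraph" where
  "tail_orientation V E f = \<lparr>pverts = V, parcs = {a. underlying_edge a \<in> E \<and> f (underlying_edge a) = fst a}\<rparr>"

text \<open>Relative to the fixed choice \<open>f\<close>, a tail choice \<open>g\<close> is encoded
  by the arcs that it would reverse; they are kept in the direction given by \<open>f\<close>, so
  that the result is a subdigraph of the orientation.\<close>

definition reversed_part ::
    "'a set \<Rightarrow> 'a set set \<Rightarrow> ('a set \<Rightarrow> 'a) \<Rightarrow> ('a set \<Rightarrow> 'a) \<Rightarrow> 'a pair_pre_digraph" where
  "reversed_part V E f g = \<lparr>pverts = V, parcs = {a \<in> parcs (tail_orientation V E f).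
      g (underlying_edge a) \<noteq> f (underlying_edge a)}\<rparr>"

context simple_graph
begin

lemma finite_edges: "finite E"
  by (rule finite_subset[of _ "Pow V"]) (use finite_vertices edge_subset in auto)

lemma finite_tail_choices: "finite (\<Pi>\<^sub>E e\<in>E. e)"
  using finite_edges edge_subset finite_vertices by (intro finite_PiE) (auto intro: finite_subset)

lemma edgeE:
  assumes "e \<in> E" "x \<in> e"
  obtains y where "e = {x, y}" "x \<noteq> y" "x \<in> V" "y \<in> V"
proof -
  obtain a b where "e = {a, b}" "a \<noteq> b" using edge_card[OF assms(1)] by (auto simp: card_2_iff)
  then show thesis using assms edge_subset[OF assms(1)] that by (cases "x = a") auto
qed

lemma inj_on_underlying_edge:
  assumes "f \<in> (\<Pi>\<^sub>E e\<in>E. e)"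
  shows "inj_on underlying_edge (parcs (tail_orientation V E f))"
proof (rule inj_onI)
  fix a b assume ab: "a \<in> parcs (tail_orientation V E f)" "b \<in> parcs (tail_orientation V E f)"
    and eq: "underlying_edge a = underlying_edge b"
  then have "fst a = fst b" by (simp add: tail_orientation_def)
  with eq show "a = b" by (auto simp: underlying_edge_def doubleton_eq_iff prod_eq_iff)
qed

lemma tail_orientation_arcE:
  assumes "f \<in> (\<Pi>\<^sub>E e\<in>E. e)" "e \<in> E"
  obtains y where "y \<in> e" "f e \<noteq> y" "\<forall>x\<in>e. x = f e \<or> x = y" "(f e, y) \<in> parcs (tail_orientation V E f)"
    "underlying_edge (f e, y) = e"
proof -
  have "f e \<in> e" using assms by (auto simp: PiE_iff)
  then obtain y where y: "e = {f e, y}" "f e \<noteq> y" by (rule edgeE[OF assms(2)])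
  have e: "underlying_edge (f e, y) = e" using y(1) by (simp add: underlying_edge_def)
  show thesis
  proof (rule that)
    show "\<forall>x\<in>e. x = f e \<or> x = y" using y(1) by blast
    show "y \<in> e" using y(1) by blast
    show "(f e, y) \<in> parcs (tail_orientation V E f)"
      using e assms(2) by (simp add: tail_orientation_def)
  qed (fact y(2) e)+
qed

text \<open>Transfers counting from arcs to edges; the degree and parity counts below rest on
  it.\<close>

lemma bij_betw_underlying_edge:
  assumes "f \<in> (\<Pi>\<^sub>E e\<in>E. e)"
    and "\<And>a. a \<in> parcs (tail_orientation V E f) \<Longrightarrow> P a \<longleftrightarrow> Q (underlying_edge a)"
  shows "bij_betw underlying_edge {a \<in> parcs (tail_orientation V E f). P a} {e \<in> E. Q e}"
proof (rule bij_betw_imageI)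
  show "inj_on underlying_edge {a \<in> parcs (tail_orientation V E f). P a}"
    using inj_on_underlying_edge[OF assms(1)] by (rule inj_on_subset) auto
  show "underlying_edge ` {a \<in> parcs (tail_orientation V E f). P a} = {e \<in> E. Q e}"
  proof (intro equalityI subsetI)
    fix e assume "e \<in> {e \<in> E. Q e}"
    then have e: "e \<in> E" "Q e" by auto
    obtain y where y: "(f e, y) \<in> parcs (tail_orientation V E f)" "underlying_edge (f e, y) = e"
      by (rule tail_orientation_arcE[OF assms(1) e(1)])
    then have "P (f e, y)" using assms(2)[of "(f e, y)"] e(2) by simp
    then show "e \<in> underlying_edge ` {a \<in> parcs (tail_orientation V E f). P a}"
      using y by (intro image_eqI[of _ _ "(f e, y)"]) simp_all
  next
    fix e assume "e \<in> underlying_edge ` {a \<in> parcs (tail_orientation V E f). P a}"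
    then obtain a where a: "a \<in> parcs (tail_orientation V E f)" "P a" "e = underlying_edge a" by blast
    then show "e \<in> {e \<in> E. Q e}"
      using assms(2)[OF a(1)] by (simp add: tail_orientation_def)
  qed
qed

lemma orientation_of_tail_orientation:
  assumes "f \<in> (\<Pi>\<^sub>E e\<in>E. e)"
  shows "orientation_of (tail_orientation V E f) V E"
proof -
  have bij: "bij_betw underlying_edge (parcs (tail_orientation V E f)) E"
    using bij_betw_underlying_edge[OF assms, of "\<lambda>_. True" "\<lambda>_. True"] by simp
  have ex1: "\<exists>!a. a \<in> parcs (tail_orientation V E f) \<and> underlying_edge a = e" if "e \<in> E" for e
  proof -
    obtain y where "(f e, y) \<in> parcs (tail_orientation V E f)" "underlying_edge (f e, y) = e"
      by (rule tail_orientation_arcE[OF assms \<open>e \<in> E\<close>])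
    note a = this
    show ?thesis
    proof (rule ex1I[of _ "(f e, y)"])
      fix b assume "b \<in> parcs (tail_orientation V E f) \<and> underlying_edge b = e"
      then show "b = (f e, y)"
        using a by (intro inj_onD[OF inj_on_underlying_edge[OF assms]]) simp_all
    qed (use a in simp)
  qed
  moreover have "pverts (tail_orientation V E f) = V" by (simp add: tail_orientation_def)
  moreover have "underlying_edge ` parcs (tail_orientation V E f) \<subseteq> E"
    using bij by (simp add: bij_betw_def)
  ultimately show ?thesis
    unfolding orientation_of_def by (intro conjI ballI ex1)
qed

lemma count_tails: "count (image_mset f (mset_set E)) v = card {e \<in> E. f e = v}"
proof -
  have "{e \<in> E. v = f e} = {e \<in> E. f e = v}" by auto
  then show ?thesis using finite_edges by (simp add: count_image_mset')
qed

lemma out_degree_tail_orientation: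
  assumes "f \<in> (\<Pi>\<^sub>E e\<in>E. e)"
  shows "out_degree (with_proj (tail_orientation V E f)) v = count (image_mset f (mset_set E)) v"
proof -
  have "out_degree (with_proj (tail_orientation V E f)) v =
      card {a \<in> parcs (tail_orientation V E f). fst a = v}"
    by (simp add: out_degree_def out_arcs_def)
  also have "\<dots> = card {e \<in> E. f e = v}"
    by (intro bij_betw_same_card[OF bij_betw_underlying_edge[OF assms]])
      (auto simp: tail_orientation_def)
  also have "\<dots> = count (image_mset f (mset_set E)) v"
    by (rule count_tails[symmetric])
  finally show ?thesis .
qed

lemma arc_head:
  assumes "a \<in> parcs (tail_orientation V E f)" "g \<in> (\<Pi>\<^sub>E e\<in>E. e)"
    "g (underlying_edge a) \<noteq> f (underlying_edge a)"
  shows "snd a = g (underlying_edge a)"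
proof -
  have "underlying_edge a \<in> E" using assms(1) by (simp add: tail_orientation_def)
  then have "g (underlying_edge a) \<in> underlying_edge a" using assms(2) by (auto simp: PiE_iff)
  then have "g (underlying_edge a) \<in> {fst a, snd a}" by (simp add: underlying_edge_def)
  then show ?thesis using assms(1,3) by (auto simp: tail_orientation_def)
qed

text \<open>A reversed arc has as its tail the tail chosen by \<open>f\<close>, and as its head the
  tail chosen by \<open>g\<close>.\<close>

lemma degrees_reversed_part:
  assumes "f \<in> (\<Pi>\<^sub>E e\<in>E. e)" "g \<in> (\<Pi>\<^sub>E e\<in>E. e)"
  shows "in_degree (with_proj (reversed_part V E f g)) v = card {e \<in> E. g e \<noteq> f e \<and> g e = v}"
    and "out_degree (with_proj (reversed_part V E f g)) v = card {e \<in> E. g e \<noteq> f e \<and> f e = v}"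
proof -
  have "in_degree (with_proj (reversed_part V E f g)) v = card {a \<in> parcs (tail_orientation V E f).
      g (underlying_edge a) \<noteq> f (underlying_edge a) \<and> snd a = v}"
    by (simp add: in_degree_def in_arcs_def reversed_part_def)
  also have "\<dots> = card {e \<in> E. g e \<noteq> f e \<and> g e = v}"
  proof (intro bij_betw_same_card[OF bij_betw_underlying_edge[OF assms(1)]])
    fix a assume "a \<in> parcs (tail_orientation V E f)"
    then show "g (underlying_edge a) \<noteq> f (underlying_edge a) \<and> snd a = v \<longleftrightarrow>
        g (underlying_edge a) \<noteq> f (underlying_edge a) \<and> g (underlying_edge a) = v"
      using arc_head[OF _ assms(2), of a f] by auto
  qed
  finally show "in_degree (with_proj (reversed_part V E f g)) v = card {e \<in> E. g e \<noteq> f e \<and> g e = v}" .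
  have "out_degree (with_proj (reversed_part V E f g)) v = card {a \<in> parcs (tail_orientation V E f).
      g (underlying_edge a) \<noteq> f (underlying_edge a) \<and> fst a = v}"
    by (simp add: out_degree_def out_arcs_def reversed_part_def)
  also have "\<dots> = card {e \<in> E. g e \<noteq> f e \<and> f e = v}"
    by (intro bij_betw_same_card[OF bij_betw_underlying_edge[OF assms(1)]])
      (auto simp: tail_orientation_def)
  finally show "out_degree (with_proj (reversed_part V E f g)) v = card {e \<in> E. g e \<noteq> f e \<and> f e = v}" .
qed

text \<open>Edges on which \<open>g\<close> and \<open>f\<close> agree contribute equally to both
  tail counts and cancel, which leaves the two degrees in the reversed part. Comparing them on
  \<open>V\<close> is enough, as no tail lies outside \<open>V\<close>.\<close>

lemma balanced_reversed_part:
  assumes f: "f \<in> (\<Pi>\<^sub>E e\<in>E. e)" and g: "g \<in> (\<Pi>\<^sub>E e\<in>E. e)"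
  shows "(\<forall>v\<in>V. in_degree (with_proj (reversed_part V E f g)) v =
      out_degree (with_proj (reversed_part V E f g)) v) \<longleftrightarrow>
    image_mset g (mset_set E) = image_mset f (mset_set E)"
proof -
  have split: "card {e \<in> E. h e = v} = card {e \<in> E. g e = f e \<and> f e = v} + card {e \<in> E. g e \<noteq> f e \<and> h e = v}"
    if "h = f \<or> h = g" for h v
  proof -
    have "{e \<in> E. h e = v} = {e \<in> E. g e = f e \<and> f e = v} \<union> {e \<in> E. g e \<noteq> f e \<and> h e = v}"
      using that by auto
    moreover have "card ({e \<in> E. g e = f e \<and> f e = v} \<union> {e \<in> E. g e \<noteq> f e \<and> h e = v}) =
        card {e \<in> E. g e = f e \<and> f e = v} + card {e \<in> E. g e \<noteq> f e \<and> h e = v}"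
      using finite_edges by (intro card_Un_disjoint) auto
    ultimately show ?thesis by simp
  qed
  have bal: "(in_degree (with_proj (reversed_part V E f g)) v =
      out_degree (with_proj (reversed_part V E f g)) v) \<longleftrightarrow>
    count (image_mset g (mset_set E)) v = count (image_mset f (mset_set E)) v" for v
    using split[of g v] split[of f v] by (simp add: degrees_reversed_part[OF f g] count_tails)
  have zero: "count (image_mset h (mset_set E)) v = 0" if "h \<in> (\<Pi>\<^sub>E e\<in>E. e)" "v \<notin> V" for h v
  proof -
    have "{e \<in> E. h e = v} = {}" using that edge_subset by (fastforce simp: PiE_iff)
    then show ?thesis by (simp only: count_tails card.empty)
  qed
  show ?thesis
  proof
    assume *: "\<forall>v\<in>V. in_degree (with_proj (reversed_part V E f g)) v =
      out_degree (with_proj (reversed_part V E f g)) v"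
    show "image_mset g (mset_set E) = image_mset f (mset_set E)"
    proof (rule multiset_eqI)
      fix v
      show "count (image_mset g (mset_set E)) v = count (image_mset f (mset_set E)) v"
        using * bal[of v] zero[OF f, of v] zero[OF g, of v] by (cases "v \<in> V") auto
    qed
  next
    assume "image_mset g (mset_set E) = image_mset f (mset_set E)"
    then show "\<forall>v\<in>V. in_degree (with_proj (reversed_part V E f g)) v =
        out_degree (with_proj (reversed_part V E f g)) v"
      unfolding bal by simp
  qed
qed

lemma bij_betw_reversed_part:
  assumes f: "f \<in> (\<Pi>\<^sub>E e\<in>E. e)"
  shows "bij_betw (reversed_part V E f)
    {g \<in> (\<Pi>\<^sub>E e\<in>E. e). image_mset g (mset_set E) = image_mset f (mset_set E)}
    (eulerian_subdigraphs (tail_orientation V E f))"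
proof (rule bij_betw_imageI)
  let ?D = "tail_orientation V E f"
  have ends: "fst a \<in> V" "snd a \<in> V" if "a \<in> parcs ?D" for a
    using that edge_subset by (auto simp: tail_orientation_def underlying_edge_def)
  have wf: "wf_digraph (with_proj H)" if "pverts H = V" "parcs H \<subseteq> parcs ?D" for H
    using that ends by unfold_locales auto
  have [simp]: "pverts ?D = V" by (simp add: tail_orientation_def)
  have span: "spanning (with_proj H) (with_proj ?D) \<longleftrightarrow> pverts H = V \<and> parcs H \<subseteq> parcs ?D" for H
    using wf[of H] wf[of ?D] by (auto simp: spanning_def subgraph_def)
  show "inj_on (reversed_part V E f) {g \<in> (\<Pi>\<^sub>E e\<in>E. e). image_mset g (mset_set E) = image_mset f (mset_set E)}"
  proof (rule inj_onI, clarify)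
    fix g h assume gh: "g \<in> (\<Pi>\<^sub>E e\<in>E. e)" "h \<in> (\<Pi>\<^sub>E e\<in>E. e)"
      and eq: "reversed_part V E f g = reversed_part V E f h"
    show "g = h"
    proof (rule PiE_ext[OF gh])
      fix e assume e: "e \<in> E"
      obtain y where y: "\<forall>x\<in>e. x = f e \<or> x = y" and a: "(f e, y) \<in> parcs ?D" "underlying_edge (f e, y) = e"
        by (rule tail_orientation_arcE[OF f e])
      have "(f e, y) \<in> parcs (reversed_part V E f g) \<longleftrightarrow> (f e, y) \<in> parcs (reversed_part V E f h)"
        using eq by simp
      then have "g e \<noteq> f e \<longleftrightarrow> h e \<noteq> f e"
        unfolding reversed_part_def using a by simp
      moreover have "g e \<in> e" "h e \<in> e"
        using gh e by (auto simp: PiE_iff)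
      then have "g e = f e \<or> g e = y" "h e = f e \<or> h e = y" using y by blast+
      ultimately show "g e = h e" by auto
    qed
  qed
  show "reversed_part V E f ` {g \<in> (\<Pi>\<^sub>E e\<in>E. e). image_mset g (mset_set E) = image_mset f (mset_set E)} =
    eulerian_subdigraphs ?D"
  proof (intro equalityI subsetI)
    fix H assume "H \<in> reversed_part V E f ` {g \<in> (\<Pi>\<^sub>E e\<in>E. e). image_mset g (mset_set E) = image_mset f (mset_set E)}"
    then obtain g where g: "g \<in> (\<Pi>\<^sub>E e\<in>E. e)" "image_mset g (mset_set E) = image_mset f (mset_set E)"
      "H = reversed_part V E f g" by blast
    then show "H \<in> eulerian_subdigraphs ?D"
      using balanced_reversed_part[OF f g(1)]
      by (auto simp: eulerian_subdigraphs_def span) (auto simp: reversed_part_def)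
  next
    fix H assume H: "H \<in> eulerian_subdigraphs ?D"
    then have Hs: "pverts H = V" "parcs H \<subseteq> parcs ?D"
      and bal: "\<forall>v\<in>V. in_degree (with_proj H) v = out_degree (with_proj H) v"
      by (auto simp: eulerian_subdigraphs_def span)
    \<comment> \<open>The inverse map: switch the tail of \<open>f\<close> on the edges used by
      \<open>H\<close>. The \<open>SOME\<close> is unambiguous because an edge has just one other
      end.\<close>
    define g where "g = (\<lambda>e\<in>E. if e \<in> underlying_edge ` parcs H then SOME y. y \<in> e \<and> y \<noteq> f e else f e)"
    have other: "g e \<in> e \<and> g e \<noteq> f e" if e: "e \<in> E" "e \<in> underlying_edge ` parcs H" for e
    proof -
      obtain y where "y \<in> e" "f e \<noteq> y" by (rule tail_orientation_arcE[OF f e(1)])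
      then have "\<exists>y. y \<in> e \<and> y \<noteq> f e" by auto
      then have "(SOME y. y \<in> e \<and> y \<noteq> f e) \<in> e \<and> (SOME y. y \<in> e \<and> y \<noteq> f e) \<noteq> f e" by (rule someI_ex)
      then show ?thesis using that by (simp add: g_def)
    qed
    have g: "g \<in> (\<Pi>\<^sub>E e\<in>E. e)"
    proof (rule PiE_I)
      fix e assume "e \<in> E"
      then show "g e \<in> e" using other[of e] f by (cases "e \<in> underlying_edge ` parcs H") (auto simp: g_def PiE_iff)
    qed (simp add: g_def)
    have "g (underlying_edge a) \<noteq> f (underlying_edge a) \<longleftrightarrow> a \<in> parcs H" if "a \<in> parcs ?D" for a
    proof -
      have "underlying_edge a \<in> E" using that by (simp add: tail_orientation_def)
      moreover have "a \<in> parcs H \<longleftrightarrow> underlying_edge a \<in> underlying_edge ` parcs H"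
        using inj_on_underlying_edge[OF f] Hs(2) that by (auto simp: inj_on_def)
      ultimately show ?thesis using other[of "underlying_edge a"] by (auto simp: g_def)
    qed
    then have "parcs (reversed_part V E f g) = parcs H"
      using Hs(2) by (auto simp: reversed_part_def)
    then have eq: "reversed_part V E f g = H"
      using Hs(1) by (simp add: reversed_part_def)
    then have "image_mset g (mset_set E) = image_mset f (mset_set E)"
      using balanced_reversed_part[OF f g] bal by simp
    then show "H \<in> reversed_part V E f ` {g \<in> (\<Pi>\<^sub>E e\<in>E. e). image_mset g (mset_set E) = image_mset f (mset_set E)}"
      using g eq by blast
  qed
qed

text \<open>Each term of the coefficient belongs to a tail choice \<open>g\<close> with the same
  outdegrees as \<open>f\<close>. Multiplied by the sign of \<open>f\<close>, it is -1 to the number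
  of positive edges on which both differ, that is, of positive arcs in the Eulerian subdigraph of
  \<open>g\<close>.\<close>

lemma sum_eulerian_subdigraphs:
  assumes f: "f \<in> (\<Pi>\<^sub>E e\<in>E. e)"
  shows "(\<Sum>H\<in>eulerian_subdigraphs (tail_orientation V E f). (-1) ^ card (positive_arcs \<sigma> H)) =
    (\<Prod>e\<in>E. tail_sign \<sigma> e (f e)) * orient_coeff (tail_sign \<sigma>) E (image_mset f (mset_set E))"
proof -
  let ?G = "{g \<in> (\<Pi>\<^sub>E e\<in>E. e). image_mset g (mset_set E) = image_mset f (mset_set E)}"
  have weight: "(-1) ^ card (positive_arcs \<sigma> (reversed_part V E f g)) =
      (\<Prod>e\<in>E. tail_sign \<sigma> e (f e)) * (\<Prod>e\<in>E. tail_sign \<sigma> e (g e))" if "g \<in> (\<Pi>\<^sub>E e\<in>E. e)" for g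
  proof -
    have "card (positive_arcs \<sigma> (reversed_part V E f g)) = card {e \<in> E. g e \<noteq> f e \<and> \<sigma> e = 1}"
      unfolding positive_arcs_def reversed_part_def
      using bij_betw_underlying_edge[OF f, of "\<lambda>a. g (underlying_edge a) \<noteq> f (underlying_edge a) \<and> \<sigma> (underlying_edge a) = 1"
          "\<lambda>e. g e \<noteq> f e \<and> \<sigma> e = 1"] by (simp add: bij_betw_same_card)
    moreover have "(\<Prod>e\<in>E. tail_sign \<sigma> e (f e)) * (\<Prod>e\<in>E. tail_sign \<sigma> e (g e)) =
        (\<Prod>e\<in>E. if g e \<noteq> f e \<and> \<sigma> e = 1 then -1 else 1)"
      unfolding prod.distrib[symmetric]
    proof (rule prod.cong[OF refl])
      fix e assume "e \<in> E"
      then show "tail_sign \<sigma> e (f e) * tail_sign \<sigma> e (g e) = (if g e \<noteq> f e \<and> \<sigma> e = 1 then -1 else 1)"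
        using tail_sign_mult[of e "f e" "g e" \<sigma>] edge_card f that by (auto simp: PiE_iff)
    qed
    moreover have "\<dots> = (\<Prod>e\<in>{e \<in> E. g e \<noteq> f e \<and> \<sigma> e = 1}. -1)"
      using finite_edges by (rule prod.inter_filter[symmetric])
    ultimately show ?thesis by (simp only: prod_constant)
  qed
  have "(\<Sum>H\<in>eulerian_subdigraphs (tail_orientation V E f). (-1) ^ card (positive_arcs \<sigma> H)) =
      (\<Sum>g\<in>?G. (-1) ^ card (positive_arcs \<sigma> (reversed_part V E f g)) :: int)"
    by (rule sum.reindex_bij_betw[OF bij_betw_reversed_part[OF f], symmetric])
  also have "\<dots> = (\<Sum>g\<in>?G. (\<Prod>e\<in>E. tail_sign \<sigma> e (f e)) * (\<Prod>e\<in>E. tail_sign \<sigma> e (g e)))"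
    by (rule sum.cong[OF refl], rule weight) simp
  also have "\<dots> = (\<Prod>e\<in>E. tail_sign \<sigma> e (f e)) * orient_coeff (tail_sign \<sigma>) E (image_mset f (mset_set E))"
    by (simp only: orient_coeff_def sum_distrib_left[symmetric] sum.inter_filter[OF finite_tail_choices])
  finally show ?thesis .
qed

text \<open>A nonzero coefficient provides a tail choice \<open>f\<close> with tail multiset
  \<open>M\<close>. Any such \<open>f\<close> will do, since another one can only change the sign of
  the difference of the two cardinalities.\<close>

lemma exists_orientation:
  assumes "orient_coeff (tail_sign \<sigma>) E M \<noteq> 0"
  obtains D where "orientation_of D V E" "card (sigma_EE \<sigma> D) \<noteq> card (sigma_OE \<sigma> D)"
    "\<forall>v. out_degree (with_proj D) v = count M v"
proof -
  obtain f where f: "f \<in> (\<Pi>\<^sub>E e\<in>E. e)" "image_mset f (mset_set E) = M"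
    using assms by (rule orient_coeff_nonzeroE)
  let ?D = "tail_orientation V E f"
  have fin: "finite (eulerian_subdigraphs ?D)"
    using bij_betw_finite[OF bij_betw_reversed_part[OF f(1)]] finite_tail_choices by simp
  have "(\<Sum>H\<in>eulerian_subdigraphs ?D. (-1) ^ card (positive_arcs \<sigma> H) :: int) =
      (\<Sum>H\<in>eulerian_subdigraphs ?D. if even (card (positive_arcs \<sigma> H)) then 1 else -1)"
    by (intro sum.cong) auto
  also have "\<dots> = int (card (sigma_EE \<sigma> ?D)) - int (card (sigma_OE \<sigma> ?D))"
    using fin by (simp add: sum.If_cases sigma_EE_def sigma_OE_def Int_def)
  finally have count: "(\<Sum>H\<in>eulerian_subdigraphs ?D. (-1) ^ card (positive_arcs \<sigma> H)) =
      int (card (sigma_EE \<sigma> ?D)) - int (card (sigma_OE \<sigma> ?D))" .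
  have "(\<Prod>e\<in>E. tail_sign \<sigma> e (f e)) \<noteq> 0"
    using finite_edges by (simp add: tail_sign_nonzero)
  then have "int (card (sigma_EE \<sigma> ?D)) - int (card (sigma_OE \<sigma> ?D)) \<noteq> 0"
    using assms sum_eulerian_subdigraphs[OF f(1), of \<sigma>] f(2) unfolding count by simp
  then show thesis
    using that[OF orientation_of_tail_orientation[OF f(1)]] out_degree_tail_orientation[OF f(1)] f(2)
    by auto
qed

end

section \<open>Cycles and Jordan curves\<close>

fun path_edges :: "'a list \<Rightarrow> 'a set set" where
  "path_edges (x # y # zs) = insert {x, y} (path_edges (y # zs))"
| "path_edges _ = {}"

lemma path_edges_append: "path_edges (xs @ y # ys) = path_edges (xs @ [y]) \<union> path_edges (y # ys)"
  by (induction xs rule: path_edges.induct) (auto simp: neq_Nil_conv)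

lemma path_edges_conv_nth: "path_edges xs = {{xs ! i, xs ! Suc i} | i. Suc i < length xs}"
proof (induction xs rule: path_edges.induct)
  case (1 x y zs)
  have "{{(x # y # zs) ! i, (x # y # zs) ! Suc i} | i. Suc i < length (x # y # zs)} =
      insert {x, y} {{(y # zs) ! i, (y # zs) ! Suc i} | i. Suc i < length (y # zs)}"
    (is "?L = insert _ ?R")
  proof (intro equalityI subsetI)
    fix e assume "e \<in> ?L"
    then obtain i where i: "e = {(x # y # zs) ! i, (x # y # zs) ! Suc i}" "Suc i < length (x # y # zs)"
      by blast
    then show "e \<in> insert {x, y} ?R" by (cases i) auto
  next
    fix e assume "e \<in> insert {x, y} ?R"
    then consider "e = {x, y}" | i where "e = {(y # zs) ! i, (y # zs) ! Suc i}" "Suc i < length (y # zs)"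
      by blast
    then show "e \<in> ?L"
    proof cases
      case 1
      then show ?thesis by (intro CollectI exI[of _ 0]) auto
    next
      case (2 i)
      then show ?thesis by (intro CollectI exI[of _ "Suc i"]) auto
    qed
  qed
  then show ?case using 1 by simp
qed auto

lemma cycle_edges_Cons: "cycle_edges (x # xs) = path_edges (x # xs @ [x])"
proof -
  have "{(x # xs) ! i, (x # xs) ! (Suc i mod length (x # xs))} =
      {(x # xs @ [x]) ! i, (x # xs @ [x]) ! Suc i}" if "i < length (x # xs)" for i
    using that by (cases "i = length xs") (auto simp: nth_append nth_Cons')
  then show ?thesis
    unfolding cycle_edges_def path_edges_conv_nth by auto
qed

lemma path_edges_rev: "path_edges (rev xs) = path_edges xs"
proof (induction xs rule: path_edges.induct)
  case (1 x y zs)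
  then show ?case using path_edges_append[of "rev zs" y "[x]"] by (auto simp: insert_commute)
qed auto

lemma cycle_edges_rotate: "cycle_edges (xs @ ys) = cycle_edges (ys @ xs)"
proof (cases "xs = [] \<or> ys = []")
  case False
  then obtain x xs' y ys' where "xs = x # xs'" "ys = y # ys'" by (auto simp: neq_Nil_conv)
  then show ?thesis
    using path_edges_append[of "x # xs'" y "ys' @ [x]"] path_edges_append[of "y # ys'" x "xs' @ [y]"]
    by (auto simp: cycle_edges_Cons)
qed auto

lemma is_cycle_rotate: "is_cycle E (xs @ ys) \<longleftrightarrow> is_cycle E (ys @ xs)"
  using cycle_edges_rotate[of xs ys] by (auto simp: is_cycle_def)

lemma Union_path_edges: "2 \<le> length xs \<Longrightarrow> \<Union>(path_edges xs) = set xs"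
proof (induction xs rule: path_edges.induct)
  case (1 x y zs)
  then show ?case by (cases zs) auto
qed auto

lemma Union_path_edges_subset: "\<Union>(path_edges xs) \<subseteq> set xs"
  by (induction xs rule: path_edges.induct) auto

lemma Union_cycle_edges: "\<Union>(cycle_edges xs) = set xs"
proof (cases xs)
  case (Cons x ys)
  then show ?thesis using Union_path_edges[of "x # ys @ [x]"] by (simp add: cycle_edges_Cons)
qed (simp add: cycle_edges_def)

context plane_graph
begin

section \<open>Edge sets as subsets of the plane\<close>

definition curve :: "complex set set \<Rightarrow> complex set" where
  "curve S = (\<Union>e\<in>S. path_image (\<gamma> e))"

text \<open>Vertices are points of the plane, so subtracting the set \<open>e\<close> removes
  precisely the two end points of the arc.\<close>

definition open_edge :: "complex set \<Rightarrow> complex set" where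
  "open_edge e = path_image (\<gamma> e) - e"

lemma curve_Un: "curve (S \<union> T) = curve S \<union> curve T"
  by (auto simp: curve_def)

lemma curve_mono: "S \<subseteq> T \<Longrightarrow> curve S \<subseteq> curve T"
  by (auto simp: curve_def)

lemma compact_curve: "S \<subseteq> E \<Longrightarrow> compact (curve S)"
  unfolding curve_def using finite_edges edge_arc
  by (intro compact_UN) (auto intro: finite_subset compact_arc_image)

lemma edge_subset_image: "e \<in> E \<Longrightarrow> e \<subseteq> path_image (\<gamma> e)"
  using edge_vertices by blast

lemma curve_vertices: "S \<subseteq> E \<Longrightarrow> curve S \<inter> V = \<Union>S"
proof -
  assume "S \<subseteq> E"
  have "curve S \<inter> V = (\<Union>e\<in>S. path_image (\<gamma> e) \<inter> V)" by (auto simp: curve_def)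
  also have "\<dots> = (\<Union>e\<in>S. e)" using edge_vertices \<open>S \<subseteq> E\<close> by (intro SUP_cong) auto
  finally show ?thesis by simp
qed

lemma curve_Int: "S \<subseteq> E \<Longrightarrow> T \<subseteq> E \<Longrightarrow> S \<inter> T = {} \<Longrightarrow> curve S \<inter> curve T \<subseteq> \<Union>S \<inter> \<Union>T"
proof
  fix p assume *: "S \<subseteq> E" "T \<subseteq> E" "S \<inter> T = {}" "p \<in> curve S \<inter> curve T"
  then obtain e f where ef: "e \<in> S" "f \<in> T" "p \<in> path_image (\<gamma> e) \<inter> path_image (\<gamma> f)"
    by (auto simp: curve_def)
  moreover have "e \<noteq> f" using ef *(3) by blast
  ultimately have "p \<in> e \<inter> f" using edges_disjoint[of e f] * by blast
  then show "p \<in> \<Union>S \<inter> \<Union>T" using ef by blast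
qed

lemma open_edge_connected: "e \<in> E \<Longrightarrow> connected (open_edge e)"
  using connected_simple_path_endless[of "\<gamma> e"] edge_arc edge_ends
  by (simp add: open_edge_def arc_imp_simple_path)

lemma open_edge_nonempty: "e \<in> E \<Longrightarrow> open_edge e \<noteq> {}"
  using nonempty_simple_path_endless[of "\<gamma> e"] edge_arc edge_ends
  by (simp add: open_edge_def arc_imp_simple_path)

lemma closure_open_edge:
  assumes "e \<in> E"
  shows "path_image (\<gamma> e) \<subseteq> closure (open_edge e)"
proof -
  have arc: "arc (\<gamma> e)" using edge_arc assms by blast
  have "continuous_on (closure {0<..<1}) (\<gamma> e)"
    using arc by (simp add: arc_def path_def)
  then have "\<gamma> e ` closure {0<..<1} \<subseteq> closure (\<gamma> e ` {0<..<1})"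
    by (rule image_closure_subset) (auto simp: closure_subset)
  then show ?thesis
    using simple_path_endless[of "\<gamma> e"] arc edge_ends[OF assms]
    by (simp add: open_edge_def arc_imp_simple_path path_image_def)
qed

lemma open_edge_Int_curve: "e \<in> E \<Longrightarrow> S \<subseteq> E \<Longrightarrow> e \<notin> S \<Longrightarrow> open_edge e \<inter> curve S = {}"
  using edges_disjoint unfolding curve_def open_edge_def by fastforce

lemma open_edge_Int_vertices: "e \<in> E \<Longrightarrow> open_edge e \<inter> V = {}"
  using edge_vertices unfolding open_edge_def by blast

lemma edge_arc_from:
  assumes "{x, y} \<in> E"
  obtains g where "arc g" "pathstart g = x" "pathfinish g = y" "path_image g = path_image (\<gamma> {x, y})"
proof (cases "pathstart (\<gamma> {x, y}) = x")
  case True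
  then have "pathfinish (\<gamma> {x, y}) = y"
    using edge_ends[OF assms] edge_card[OF assms] by (auto simp: doubleton_eq_iff)
  then show thesis using that[of "\<gamma> {x, y}"] True edge_arc[OF assms] by blast
next
  case False
  then have "pathstart (\<gamma> {x, y}) = y" "pathfinish (\<gamma> {x, y}) = x"
    using edge_ends[OF assms] by (auto simp: doubleton_eq_iff)
  then show thesis
    using that[of "reversepath (\<gamma> {x, y})"] edge_arc[OF assms] by (simp add: arc_reversepath)
qed

lemma path_arc:
  assumes "distinct xs" "2 \<le> length xs" "path_edges xs \<subseteq> E"
  obtains g where "arc g" "pathstart g = hd xs" "pathfinish g = last xs"
    "path_image g = curve (path_edges xs)"
proof -
  have "\<exists>g. arc g \<and> pathstart g = hd xs \<and> pathfinish g = last xs \<and> path_image g = curve (path_edges xs)"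
    using assms
  proof (induction xs rule: path_edges.induct)
    case (1 x y zs)
    have xy: "{x, y} \<in> E" using 1 by simp
    then obtain g where g: "arc g" "pathstart g = x" "pathfinish g = y"
      "path_image g = path_image (\<gamma> {x, y})"
      by (rule edge_arc_from)
    show ?case
    proof (cases zs)
      case Nil
      then show ?thesis using g by (auto simp: curve_def)
    next
      case (Cons z zs')
      then obtain h where h: "arc h" "pathstart h = y" "pathfinish h = last (y # zs)"
        "path_image h = curve (path_edges (y # zs))"
        using 1 by auto
      have sub: "\<Union>(path_edges (y # zs)) \<subseteq> set (y # zs)" by (rule Union_path_edges_subset)
      have "x \<notin> set (y # zs)" using "1.prems"(1) by simp
      then have "{x, y} \<notin> path_edges (y # zs)" using sub by blast
      then have "path_image g \<inter> path_image h \<subseteq> {x, y} \<inter> \<Union>(path_edges (y # zs))"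
        using curve_Int[of "{{x, y}}" "path_edges (y # zs)"] "1.prems"(3) g(4) h(4)
        by (simp add: curve_def)
      then have "path_image g \<inter> path_image h \<subseteq> {pathstart h}"
        using sub \<open>x \<notin> set (y # zs)\<close> h(2) by blast
      then have "arc (g +++ h)" using g h by (intro arc_join) auto
      moreover have "path_image (g +++ h) = curve (path_edges (x # y # zs))"
        using g h by (simp add: path_image_join curve_def)
      ultimately show ?thesis using g h Cons by (intro exI[of _ "g +++ h"]) simp
    qed
  qed auto
  then show thesis using that by blast
qed

lemma cycle_loop:
  assumes "is_cycle E L"
  obtains g where "simple_path g" "pathfinish g = pathstart g" "path_image g = curve (cycle_edges L)"
proof -
  have L: "distinct L" "3 \<le> length L" "cycle_edges L \<subseteq> E" using assms by (auto simp: is_cycle_def)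
  then obtain x y z zs where Lx: "L = x # y # z # zs"
    by (metis Suc_le_length_iff numeral_3_eq_3)
  define b where "b = last (z # zs)"
  have ce: "cycle_edges L = path_edges L \<union> {{b, x}}"
  proof -
    have "L = butlast L @ [b]" using Lx by (simp add: b_def)
    then have "path_edges (L @ [x]) = path_edges (butlast L @ [b]) \<union> path_edges [b, x]"
      using path_edges_append[of "butlast L" b "[x]"] by (metis append.assoc append_Cons append_Nil)
    then show ?thesis using Lx \<open>L = butlast L @ [b]\<close> cycle_edges_Cons[of x "y # z # zs"]
      by (metis append_Cons path_edges.simps(1,3))
  qed
  obtain g where g: "arc g" "pathstart g = x" "pathfinish g = b" "path_image g = curve (path_edges L)"
    using path_arc[of L] L ce Lx b_def by auto
  have bx: "{b, x} \<in> E" using L ce by auto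
  then obtain h where h: "arc h" "pathstart h = b" "pathfinish h = x" "path_image h = path_image (\<gamma> {b, x})"
    by (rule edge_arc_from)
  \<comment> \<open>Length at least 3 enters here: the last vertex differs from \<open>y\<close>, so
    the closing edge does not repeat the first edge of the path.\<close>
  have "b \<in> set (z # zs)" unfolding b_def by (rule last_in_set) simp
  then have "b \<noteq> x" "b \<noteq> y" using L(1) Lx by auto
  have "\<Union>(path_edges (y # z # zs)) \<subseteq> set (y # z # zs)" by (rule Union_path_edges_subset)
  moreover have "x \<notin> set (y # z # zs)" using L(1) Lx by simp
  ultimately have "{b, x} \<notin> path_edges (y # z # zs)" by blast
  then have "{b, x} \<notin> path_edges L"
    using \<open>b \<noteq> x\<close> \<open>b \<noteq> y\<close> by (simp add: Lx doubleton_eq_iff)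
  then have "curve (path_edges L) \<inter> curve {{b, x}} \<subseteq> {b, x}"
    using curve_Int[of "path_edges L" "{{b, x}}"] L ce bx by auto
  then have "path_image g \<inter> path_image h \<subseteq> {pathstart g, pathstart h}"
    using g h by (auto simp: curve_def)
  then have "simple_path (g +++ h)" using g h by (intro simple_path_join_loop) auto
  moreover have "path_image (g +++ h) = curve (cycle_edges L)"
    using g h ce by (simp add: path_image_join curve_Un) (simp add: curve_def Un_commute)
  ultimately show thesis using that g h by simp
qed

lemma cycle_jordan:
  assumes "is_cycle E L"
  defines "J \<equiv> curve (cycle_edges L)"
  shows "open (inside J)" "connected (inside J)" "bounded (inside J)" "inside J \<noteq> {}"
    "open (outside J)" "connected (outside J)" "\<not> bounded (outside J)"
    "frontier (inside J) = J" "inside J \<union> outside J = - J" "inside J \<inter> outside J = {}"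
    "closure (inside J) = inside J \<union> J"
proof -
  obtain g where g: "simple_path g" "pathfinish g = pathstart g" "path_image g = J"
    using cycle_loop[OF assms(1)] unfolding J_def by blast
  have *: "inside J \<noteq> {} \<and> open (inside J) \<and> connected (inside J) \<and> outside J \<noteq> {} \<and>
    open (outside J) \<and> connected (outside J) \<and> bounded (inside J) \<and> \<not> bounded (outside J) \<and>
    inside J \<inter> outside J = {} \<and> inside J \<union> outside J = - J \<and>
    frontier (inside J) = J \<and> frontier (outside J) = J"
    using Jordan_inside_outside[OF g(1,2)] unfolding g(3) .
  then show "open (inside J)" "connected (inside J)" "bounded (inside J)" "inside J \<noteq> {}"
    "open (outside J)" "connected (outside J)" "\<not> bounded (outside J)"
    "frontier (inside J) = J" "inside J \<union> outside J = - J" "inside J \<inter> outside J = {}"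
    by blast+
  show "closure (inside J) = inside J \<union> J"
    using closure_Un_frontier[of "inside J"] * by simp
qed

end

section \<open>Cutting a disc along a path\<close>

context plane_graph
begin

definition region :: "complex set set \<Rightarrow> complex set" where
  "region S = inside (curve S)"

text \<open>The edge set on which the induction runs. It is selected by position in the drawing, so
  passing to a smaller cycle requires no new plane graph and no new faces.\<close>

definition disc_edges :: "complex set set \<Rightarrow> complex set set" where
  "disc_edges S = {e \<in> E. path_image (\<gamma> e) \<subseteq> curve S \<union> region S}"

lemma region_disjoint: "region S \<inter> curve S = {}"
  by (simp add: region_def)

lemma disc_edges_subset: "disc_edges S \<subseteq> E"
  by (auto simp: disc_edges_def)

lemma boundary_subset_disc_edges: "S \<subseteq> E \<Longrightarrow> S \<subseteq> disc_edges S"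
  by (auto simp: disc_edges_def curve_def)

lemma Union_disc_edges:
  assumes "S \<subseteq> E"
  shows "\<Union>(disc_edges S) \<subseteq> \<Union>S \<union> (V \<inter> region S)"
proof
  fix v assume "v \<in> \<Union>(disc_edges S)"
  then obtain e where e: "e \<in> E" "v \<in> e" "path_image (\<gamma> e) \<subseteq> curve S \<union> region S"
    by (auto simp: disc_edges_def)
  then have "v \<in> V" "v \<in> curve S \<union> region S" using edge_vertices[of e] by auto
  then show "v \<in> \<Union>S \<union> (V \<inter> region S)" using curve_vertices[OF assms] by blast
qed

lemma open_edge_subset_region:
  assumes "S \<subseteq> E" "e \<in> disc_edges S" "e \<notin> S"
  shows "open_edge e \<subseteq> region S"
proof -
  have "e \<in> E" "open_edge e \<subseteq> curve S \<union> region S"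
    using assms by (auto simp: disc_edges_def open_edge_def)
  then show ?thesis using open_edge_Int_curve[of e S] assms by blast
qed

text \<open>The three paths form a theta curve, and \<open>chord\<close> makes \<open>c\<close> the
  middle one. Once the lists are turned into arcs, this is the splitting of the interior of a Jordan
  curve by an arc across it.\<close>

lemma theta_interiors:
  assumes paths: "distinct p" "distinct q" "distinct c" "2 \<le> length p" "2 \<le> length q" "2 \<le> length c"
    "path_edges p \<subseteq> E" "path_edges q \<subseteq> E" "path_edges c \<subseteq> E"
    and ends: "hd p = a" "last p = b" "hd q = a" "last q = b" "hd c = a" "last c = b" "a \<noteq> b"
    and meet: "set p \<inter> set q = {a, b}" "set p \<inter> set c = {a, b}" "set q \<inter> set c = {a, b}"
    and disj: "path_edges p \<inter> path_edges q = {}" "path_edges p \<inter> path_edges c = {}"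
      "path_edges q \<inter> path_edges c = {}"
    and chord: "curve (path_edges c) \<inter> region (path_edges p \<union> path_edges q) \<noteq> {}"
  shows "region (path_edges p \<union> path_edges c) \<inter> region (path_edges q \<union> path_edges c) = {}"
    and "region (path_edges p \<union> path_edges c) \<union> region (path_edges q \<union> path_edges c) \<union>
      (curve (path_edges c) - {a, b}) = region (path_edges p \<union> path_edges q)"
    and "curve (path_edges p) \<inter> curve (path_edges q) = {a, b}"
proof -
  have ab: "{a, b} \<subseteq> \<Union>(path_edges r)" if "2 \<le> length r" "hd r = a" "last r = b" for r
    using Union_path_edges[OF that(1)] that by (cases r) auto
  have sub: "\<Union>(path_edges r) \<subseteq> curve (path_edges r)" if "path_edges r \<subseteq> E" for r
    using edge_subset_image that by (fastforce simp: curve_def)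
  have meet_curve: "curve (path_edges r) \<inter> curve (path_edges s) = {a, b}"
    if "2 \<le> length r" "2 \<le> length s" "hd r = a" "last r = b" "hd s = a" "last s = b"
      "path_edges r \<subseteq> E" "path_edges s \<subseteq> E" "path_edges r \<inter> path_edges s = {}" "set r \<inter> set s = {a, b}" for r s
  proof
    show "curve (path_edges r) \<inter> curve (path_edges s) \<subseteq> {a, b}"
      using curve_Int[OF that(7-9)] Union_path_edges_subset[of r] Union_path_edges_subset[of s] that(10) by blast
    show "{a, b} \<subseteq> curve (path_edges r) \<inter> curve (path_edges s)"
      using ab[OF that(1,3,4)] ab[OF that(2,5,6)] sub[OF that(7)] sub[OF that(8)] by blast
  qed
  obtain gp where gp: "arc gp" "pathstart gp = hd p" "pathfinish gp = last p"
    "path_image gp = curve (path_edges p)"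
    using path_arc[OF paths(1,4,7)] by blast
  obtain gq where gq: "arc gq" "pathstart gq = hd q" "pathfinish gq = last q"
    "path_image gq = curve (path_edges q)"
    using path_arc[OF paths(2,5,8)] by blast
  obtain gc where gc: "arc gc" "pathstart gc = hd c" "pathfinish gc = last c"
    "path_image gc = curve (path_edges c)"
    using path_arc[OF paths(3,6,9)] by blast
  show pq: "curve (path_edges p) \<inter> curve (path_edges q) = {a, b}"
    using meet_curve paths ends meet disj by simp
  have pc: "curve (path_edges p) \<inter> curve (path_edges c) = {a, b}"
    using meet_curve paths ends meet disj by simp
  have qc: "curve (path_edges q) \<inter> curve (path_edges c) = {a, b}"
    using meet_curve paths ends meet disj by simp
  have ne: "path_image gc \<inter> inside (path_image gp \<union> path_image gq) \<noteq> {}"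
    using chord gp gq gc by (simp add: region_def curve_Un)
  have "inside (path_image gp \<union> path_image gc) \<inter> inside (path_image gq \<union> path_image gc) = {} \<and>
    inside (path_image gp \<union> path_image gc) \<union> inside (path_image gq \<union> path_image gc) \<union>
      (path_image gc - {a, b}) = inside (path_image gp \<union> path_image gq)"
    by (rule split_inside_simple_closed_curve[of gp a b gq gc])
      (use gp gq gc ends pq pc qc ne in \<open>simp_all add: arc_imp_simple_path\<close>)
  then show "region (path_edges p \<union> path_edges c) \<inter> region (path_edges q \<union> path_edges c) = {}"
    and "region (path_edges p \<union> path_edges c) \<union> region (path_edges q \<union> path_edges c) \<union>
      (curve (path_edges c) - {a, b}) = region (path_edges p \<union> path_edges q)"
    unfolding region_def curve_Un gp(4) gq(4) gc(4) by blast+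
qed

text \<open>
  The open edges other than those of the theta curve are connected, hence lie on one side of \<open>U\<close>.
\<close>

lemma theta_disc_edges:
  assumes sub: "S \<subseteq> E" "T \<subseteq> E" "U \<subseteq> E"
    and jordan: "open (region (S \<union> U))" "open (region (T \<union> U))"
      "closure (region (S \<union> U)) = region (S \<union> U) \<union> curve (S \<union> U)"
      "closure (region (T \<union> U)) = region (T \<union> U) \<union> curve (T \<union> U)"
    and disj: "region (S \<union> U) \<inter> region (T \<union> U) = {}"
    and split: "region (S \<union> U) \<union> region (T \<union> U) \<union> (curve U - {a, b}) = region (S \<union> T)"
    and meet: "curve S \<inter> curve T = {a, b}" and ab: "{a, b} \<subseteq> V"
  shows "disc_edges (S \<union> T) = disc_edges (S \<union> U) \<union> disc_edges (T \<union> U)"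
    and "disc_edges (S \<union> U) \<inter> disc_edges (T \<union> U) = U"
proof -
  have avoid: "region (S \<union> T) \<inter> (curve S \<union> curve T) = {}"
    using region_disjoint[of "S \<union> T"] by (simp add: curve_Un)
  show "disc_edges (S \<union> T) = disc_edges (S \<union> U) \<union> disc_edges (T \<union> U)"
  proof
    show "disc_edges (S \<union> U) \<union> disc_edges (T \<union> U) \<subseteq> disc_edges (S \<union> T)"
      using split meet unfolding disc_edges_def curve_Un by blast
    show "disc_edges (S \<union> T) \<subseteq> disc_edges (S \<union> U) \<union> disc_edges (T \<union> U)"
    proof
      fix e assume e: "e \<in> disc_edges (S \<union> T)"
      then have eE: "e \<in> E" by (simp add: disc_edges_def)
      show "e \<in> disc_edges (S \<union> U) \<union> disc_edges (T \<union> U)"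
      proof (cases "e \<in> S \<union> T \<union> U")
        case True
        then show ?thesis
          using boundary_subset_disc_edges[of "S \<union> U"] boundary_subset_disc_edges[of "T \<union> U"] sub by blast
      next
        case False
        have "open_edge e \<subseteq> region (S \<union> T)"
          using open_edge_subset_region[of "S \<union> T" e] e sub False by blast
        then have "open_edge e \<subseteq> region (S \<union> U) \<union> region (T \<union> U)"
          using split open_edge_Int_curve[OF eE sub(3)] False by blast
        then have "open_edge e \<subseteq> region (S \<union> U) \<or> open_edge e \<subseteq> region (T \<union> U)"
          using connectedD[OF open_edge_connected[OF eE] jordan(1,2)] disj by blast
        \<comment> \<open>The ends are recovered by closure: a whole edge lies in the closure of the
          side containing its open part, and this closure is the closed disc.\<close>
        then have "path_image (\<gamma> e) \<subseteq> closure (region (S \<union> U)) \<or>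
            path_image (\<gamma> e) \<subseteq> closure (region (T \<union> U))"
          using closure_open_edge[OF eE] closure_mono by blast
        then show ?thesis
          using eE unfolding jordan(3,4) disc_edges_def by blast
      qed
    qed
  qed
  show "disc_edges (S \<union> U) \<inter> disc_edges (T \<union> U) = U"
  proof
    show "U \<subseteq> disc_edges (S \<union> U) \<inter> disc_edges (T \<union> U)"
      using boundary_subset_disc_edges[of "S \<union> U"] boundary_subset_disc_edges[of "T \<union> U"] sub by blast
    show "disc_edges (S \<union> U) \<inter> disc_edges (T \<union> U) \<subseteq> U"
    proof (rule subsetI, rule ccontr)
      fix e assume e: "e \<in> disc_edges (S \<union> U) \<inter> disc_edges (T \<union> U)" and nU: "e \<notin> U"
      then have eE: "e \<in> E" by (simp add: disc_edges_def)
      obtain x where x: "x \<in> open_edge e" using open_edge_nonempty[OF eE] by blast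
      then have "x \<notin> curve U" "x \<notin> V"
        using open_edge_Int_curve[OF eE sub(3) nU] open_edge_Int_vertices[OF eE] by blast+
      moreover have "x \<in> curve S \<union> curve U \<union> region (S \<union> U)" "x \<in> curve T \<union> curve U \<union> region (T \<union> U)"
        using e x by (auto simp: disc_edges_def open_edge_def curve_Un)
      \<comment> \<open>The curves of \<open>S\<close> and \<open>T\<close> meet only in the
        vertices \<open>a\<close> and \<open>b\<close>, each open side misses both curves, and the
        open sides are disjoint; \<open>x\<close> would have to lie in one of these
        intersections.\<close>
      ultimately show False using disj split avoid meet ab by blast
    qed
  qed
qed

end

section \<open>Faces\<close>

context plane_graph
begin

lemma region_jordan:
  assumes "is_cycle E L"
  shows "open (region (cycle_edges L))" "connected (region (cycle_edges L))"
    "bounded (region (cycle_edges L))" "region (cycle_edges L) \<noteq> {}"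
    "frontier (region (cycle_edges L)) = curve (cycle_edges L)"
    "closure (region (cycle_edges L)) = region (cycle_edges L) \<union> curve (cycle_edges L)"
  unfolding region_def using cycle_jordan[OF assms] by simp_all

lemma plane_points_eq: "plane_points V E \<gamma> = V \<union> curve E"
  by (simp add: plane_points_def curve_def)

lemma cycle_points_eq:
  assumes "is_cycle E L"
  shows "plane_points (set L) (cycle_edges L) \<gamma> = curve (cycle_edges L)"
proof -
  have "set L \<subseteq> curve (cycle_edges L)"
    using curve_vertices[of "cycle_edges L"] assms Union_cycle_edges[of L] by (auto simp: is_cycle_def)
  then show ?thesis by (auto simp: plane_points_def curve_def)
qed

lemma compact_plane_points: "compact (V \<union> curve E)"
  using finite_vertices compact_curve[of E] by (simp add: compact_Un finite_imp_compact)

lemma face_properties: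
  assumes "F \<in> faces V E \<gamma>"
  shows "open F" "connected F" "F \<noteq> {}" "F \<inter> V = {}" "F \<inter> curve E = {}"
proof -
  have F: "F \<in> components (- (V \<union> curve E))"
    using assms by (simp add: faces_def plane_points_eq)
  show "open F" 
    using open_components[OF open_Compl[OF compact_imp_closed[OF compact_plane_points]] F] by blast
  show "connected F" "F \<noteq> {}" using F in_components_connected in_components_nonempty by blast+
  have "F \<subseteq> - (V \<union> curve E)" using in_components_subset[OF F] .
  then show "F \<inter> V = {}" "F \<inter> curve E = {}" by blast+
qed

lemma open_subset_eq_connected:
  assumes "connected U" "open F" "F \<noteq> {}" "F \<subseteq> U" "frontier F \<inter> U = {}"
  shows "F = U"
  using connected_Int_frontier[OF assms(1), of F] assms by blast

lemma cycle_side: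
  assumes L: "is_cycle E L" and F: "F \<in> faces V E \<gamma>"
  shows "F \<subseteq> region (cycle_edges L) \<or> F \<subseteq> outside (curve (cycle_edges L))"
proof -
  let ?J = "curve (cycle_edges L)"
  note J = cycle_jordan[OF L]
  have "?J \<subseteq> curve E" using L by (intro curve_mono) (simp add: is_cycle_def)
  then have "F \<subseteq> inside ?J \<union> outside ?J" using face_properties(5)[OF F] J(9) by blast
  then show ?thesis
    using connectedD[OF face_properties(2)[OF F] J(1,5)] J(10) unfolding region_def by blast
qed

text \<open>The face lies on one side of the cycle. Its frontier is the cycle, which that side
  avoids, so by connectedness the face fills the side. Boundedness tells which side it is.\<close>

lemma face_bounded_by_cycle:
  assumes F: "F \<in> faces V E \<gamma>" and L: "bounded_by_cycle E \<gamma> F L"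
  shows "bounded F \<Longrightarrow> F = region (cycle_edges L)"
    and "\<not> bounded F \<Longrightarrow> F = outside (curve (cycle_edges L))"
proof -
  let ?J = "curve (cycle_edges L)"
  have cyc: "is_cycle E L" and fr: "frontier F = ?J"
    using L cycle_points_eq by (auto simp: bounded_by_cycle_def)
  note J = cycle_jordan[OF cyc]
  have J_cover: "inside ?J \<inter> ?J = {}" "outside ?J \<inter> ?J = {}"
    "?J \<inter> inside ?J = {}" "?J \<inter> outside ?J = {}" by (simp_all only: inside_no_overlap outside_no_overlap Int_commute[of ?J])
  consider "F \<subseteq> inside ?J" | "F \<subseteq> outside ?J"
    using cycle_side[OF cyc F] unfolding region_def by blast
  then have "F = inside ?J \<or> F = outside ?J"
  proof cases
    case 1
    then have "F = inside ?J"
      using fr J_cover by (intro open_subset_eq_connected[OF J(2) face_properties(1,3)[OF F]]) simp_all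
    then show ?thesis ..
  next
    case 2
    then have "F = outside ?J"
      using fr J_cover by (intro open_subset_eq_connected[OF J(6) face_properties(1,3)[OF F]]) simp_all
    then show ?thesis ..
  qed
  then show "bounded F \<Longrightarrow> F = region (cycle_edges L)"
    and "\<not> bounded F \<Longrightarrow> F = outside (curve (cycle_edges L))"
    using J(3,7) unfolding region_def by blast+
qed

end

context near_triangulation
begin

text \<open>The drawing is compact, so there is an unbounded face. It is the whole outside of
  \<open>C\<close>, hence nothing is drawn there.\<close>

lemma outer_cycle_disc:
  shows "is_cycle E C" "disc_edges (cycle_edges C) = E" "V - set C \<subseteq> region (cycle_edges C)"
proof -
  let ?J = "curve (cycle_edges C)"
  have "bounded (- (- (V \<union> curve E)))" using compact_imp_bounded[OF compact_plane_points] by simp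
  then obtain F where "F \<in> components (- (V \<union> curve E))" "\<not> bounded F"
    using cobounded_unbounded_components by blast
  then have F: "F \<in> faces V E \<gamma>" "\<not> bounded F" by (simp_all add: faces_def plane_points_eq)
  then have L: "bounded_by_cycle E \<gamma> F C" by (rule outer_cycle)
  then show cyc: "is_cycle E C" by (simp add: bounded_by_cycle_def)
  have "F = outside ?J" by (rule face_bounded_by_cycle(2)[OF F(1) L F(2)])
  then have sub: "V \<union> curve E \<subseteq> ?J \<union> region (cycle_edges C)"
    using face_properties(4,5)[OF F(1)] cycle_jordan(9)[OF cyc] unfolding region_def by blast
  then show "disc_edges (cycle_edges C) = E" by (auto simp: disc_edges_def curve_def)
  have "V \<inter> ?J = set C"
    using curve_vertices[of "cycle_edges C"] Union_cycle_edges[of C] cyc by (auto simp: is_cycle_def)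
  then show "V - set C \<subseteq> region (cycle_edges C)" using sub by blast
qed

lemma inner_face_triangle:
  assumes "F \<in> faces V E \<gamma>" "bounded F"
  obtains x y z where "is_cycle E [x, y, z]" "F = region (cycle_edges [x, y, z])"
    "frontier F = curve (cycle_edges [x, y, z])"
proof -
  obtain T where T: "length T = 3" "bounded_by_cycle E \<gamma> F T" using inner_triangle assms by blast
  then obtain x y z where T_eq: "T = [x, y, z]" by (auto simp: numeral_3_eq_3 length_Suc_conv)
  have cyc: "is_cycle E T" using T(2) by (simp add: bounded_by_cycle_def)
  have reg: "F = region (cycle_edges T)" by (rule face_bounded_by_cycle(1)[OF assms(1) T(2) assms(2)])
  have fr: "frontier F = curve (cycle_edges T)"
    using T(2) cycle_points_eq[OF cyc] by (simp add: bounded_by_cycle_def)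
  show thesis by (rule that[OF cyc[unfolded T_eq] reg[unfolded T_eq] fr[unfolded T_eq]])
qed

text \<open>An inner face is recovered from the three vertices of its triangle as the inside of that
  curve, and there are only finitely many triples of vertices.\<close>

lemma finite_inner_faces: "finite {F \<in> faces V E \<gamma>. bounded F}"
proof (rule finite_subset)
  show "{F \<in> faces V E \<gamma>. bounded F} \<subseteq> (\<lambda>(x, y, z). region (cycle_edges [x, y, z])) ` (V \<times> V \<times> V)"
  proof
    fix F assume "F \<in> {F \<in> faces V E \<gamma>. bounded F}"
    then have F: "F \<in> faces V E \<gamma>" "bounded F" by simp_all
    obtain x y z where T: "is_cycle E [x, y, z]" "F = region (cycle_edges [x, y, z])"
      by (rule inner_face_triangle[OF F])
    have "cycle_edges [x, y, z] \<subseteq> E" using T(1) by (simp add: is_cycle_def)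
    then have "\<Union>(cycle_edges [x, y, z]) \<subseteq> V" using edge_subset by blast
    then have "set [x, y, z] \<subseteq> V" by (simp only: Union_cycle_edges)
    then show "F \<in> (\<lambda>(x, y, z). region (cycle_edges [x, y, z])) ` (V \<times> V \<times> V)"
      unfolding T(2) by (intro image_eqI[of _ _ "(x, y, z)"]) simp_all
  qed
qed (use finite_vertices in simp)

text \<open>
  Points of the region close to an interior point \<open>p\<close> of the edge lie in inner faces. There are
  finitely many of these, so \<open>p\<close> is on the frontier of one of them.
\<close>

lemma inner_face_at_edge:
  assumes L: "is_cycle E L" and e: "e \<in> cycle_edges L"
  obtains F where "F \<in> faces V E \<gamma>" "F \<subseteq> region (cycle_edges L)" "open_edge e \<inter> frontier F \<noteq> {}"
proof -
  let ?J = "curve (cycle_edges L)" and ?R = "region (cycle_edges L)"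
  note R = region_jordan[OF L]
  have sub: "cycle_edges L \<subseteq> E" and eE: "e \<in> E" using L e by (auto simp: is_cycle_def)
  obtain p where p: "p \<in> open_edge e" using open_edge_nonempty[OF eE] by blast
  let ?K = "V \<union> curve (E - {e})"
  let ?FF = "{F \<in> faces V E \<gamma>. F \<subseteq> ?R}"
  have fin: "finite ?FF"
    using finite_inner_faces by (rule rev_finite_subset) (use R(3) bounded_subset in blast)
  have "closed ?K"
    using finite_vertices compact_curve[of "E - {e}"] by (intro compact_imp_closed) (simp add: compact_Un finite_imp_compact)
  moreover have "p \<notin> ?K"
    using p open_edge_Int_vertices[OF eE] open_edge_Int_curve[OF eE, of "E - {e}"] by blast
  ultimately have K: "open (- ?K)" "p \<in> - ?K" by (simp_all only: open_Compl Compl_iff not_False_eq_True)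
  have pJ: "p \<in> ?J" using p e by (auto simp: open_edge_def curve_def)
  have "p \<in> closure (\<Union>?FF)"
    unfolding closure_iff_nhds_not_empty
  proof (intro allI impI)
    fix A U assume A: "U \<subseteq> A" "open U" "p \<in> U"
    have "p \<in> closure ?R" using pJ R(6) by blast
    \<comment> \<open>Avoiding \<open>?K\<close> keeps the point off all vertices and all other
      edges, and lying in the open region keeps it off \<open>e\<close> as well; so it belongs to a
      face.\<close>
    then have "?R \<inter> (U \<inter> - ?K) \<noteq> {}"
      using A K open_Int_closure_eq_empty[of "U \<inter> - ?K" ?R] by blast
    then obtain x where x: "x \<in> ?R" "x \<in> U" "x \<notin> ?K" by blast
    have "x \<notin> path_image (\<gamma> e)" using x(1) region_disjoint[of "cycle_edges L"] e by (auto simp: curve_def)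
    then have "x \<in> - (V \<union> curve E)" using x(3) by (auto simp: curve_def)
    then obtain F where F: "F \<in> components (- (V \<union> curve E))" "x \<in> F"
      using Union_components by blast
    then have Ff: "F \<in> faces V E \<gamma>" by (simp add: faces_def plane_points_eq)
    then have "F \<subseteq> ?R"
      using cycle_side[OF L Ff] F(2) x(1) cycle_jordan(10)[OF L] unfolding region_def by blast
    then show "\<Union>?FF \<inter> A \<noteq> {}" using Ff F(2) x(2) A(1) by blast
  qed
  \<comment> \<open>Finiteness is used here: a finite union of closures is closed, so a single face
    has \<open>p\<close> in its closure.\<close>
  also have "closure (\<Union>?FF) \<subseteq> (\<Union>F\<in>?FF. closure F)"
    using fin by (intro closure_minimal closed_UN) (use closure_subset in blast)+
  finally obtain F where F: "F \<in> ?FF" "p \<in> closure F" by blast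
  have Ff: "F \<in> faces V E \<gamma>" "F \<subseteq> ?R" using F(1) by auto
  have "p \<notin> F" using Ff(2) pJ region_disjoint by blast
  then have "p \<in> frontier F"
    using F(2) face_properties(1)[OF Ff(1)] by (simp add: frontier_def interior_open)
  then show thesis using that[OF Ff] p by blast
qed

text \<open>The open edge touches the frontier of a face inside the cycle, and this frontier is a
  triangle. Distinct edges meet only in ends, so the edge is one of its sides. The inside of the
  triangle is a face and therefore holds no vertex and no edge.\<close>

lemma triangle_at_edge:
  assumes L: "is_cycle E L" and e: "{a, b} \<in> cycle_edges L"
  obtains w where "is_cycle E [a, b, w]" "disc_edges (cycle_edges [a, b, w]) = cycle_edges [a, b, w]"
    "region (cycle_edges [a, b, w]) \<inter> V = {}"
    "region (cycle_edges [a, b, w]) \<subseteq> region (cycle_edges L)"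
    "cycle_edges [a, b, w] \<subseteq> disc_edges (cycle_edges L)"
proof -
  have eE: "{a, b} \<in> E" using L e by (auto simp: is_cycle_def)
  obtain F where F: "F \<in> faces V E \<gamma>" "F \<subseteq> region (cycle_edges L)"
    "open_edge {a, b} \<inter> frontier F \<noteq> {}"
    using inner_face_at_edge[OF L e] by blast
  have "bounded F" using F(2) region_jordan(3)[OF L] bounded_subset by blast
  then obtain x y z where T: "is_cycle E [x, y, z]" "F = region (cycle_edges [x, y, z])"
    "frontier F = curve (cycle_edges [x, y, z])"
    by (rule inner_face_triangle[OF F(1)])
  have "{a, b} \<in> cycle_edges [x, y, z]"
    using open_edge_Int_curve[OF eE, of "cycle_edges [x, y, z]"] F(3) T(1,3) by (auto simp: is_cycle_def)
  then have "{a, b} = {x, y} \<or> {a, b} = {y, z} \<or> {a, b} = {z, x}"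
    by (auto simp: cycle_edges_Cons)
  then obtain w where w: "set [a, b, w] = set [x, y, z]" "cycle_edges [a, b, w] = cycle_edges [x, y, z]"
    "distinct [a, b, w]"
  proof (elim disjE)
    assume "{a, b} = {x, y}"
    then show thesis using that[of z] T(1) by (auto simp: doubleton_eq_iff is_cycle_def cycle_edges_Cons insert_commute)
  next
    assume "{a, b} = {y, z}"
    then show thesis using that[of x] T(1) by (auto simp: doubleton_eq_iff is_cycle_def cycle_edges_Cons insert_commute)
  next
    assume "{a, b} = {z, x}"
    then show thesis using that[of y] T(1) by (auto simp: doubleton_eq_iff is_cycle_def cycle_edges_Cons insert_commute)
  qed
  let ?T = "cycle_edges [a, b, w]"
  have cyc: "is_cycle E [a, b, w]" using T(1) w by (simp add: is_cycle_def)
  have reg: "region ?T = F" using w(2) T(2) by simp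
  have subE: "?T \<subseteq> E" using cyc by (simp add: is_cycle_def)
  show thesis
  proof (rule that[OF cyc])
    show "disc_edges ?T = ?T"
    proof
      show "disc_edges ?T \<subseteq> ?T"
      proof (rule subsetI, rule ccontr)
        fix e assume e: "e \<in> disc_edges ?T" "e \<notin> ?T"
        then have "e \<in> E" by (simp add: disc_edges_def)
        moreover have "open_edge e \<subseteq> F" using open_edge_subset_region[OF subE e] reg by simp
        moreover have "open_edge e \<subseteq> curve E" using \<open>e \<in> E\<close> by (auto simp: open_edge_def curve_def)
        ultimately show False using open_edge_nonempty face_properties(5)[OF F(1)] by blast
      qed
    qed (rule boundary_subset_disc_edges[OF subE])
    show "region ?T \<inter> V = {}" using face_properties(4)[OF F(1)] reg by simp
    show "region ?T \<subseteq> region (cycle_edges L)" using F(2) reg by simp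
    have "curve ?T \<subseteq> closure (region (cycle_edges L))"
      using T(3) w(2) closure_mono[OF F(2)] by (auto simp: frontier_def)
    then show "?T \<subseteq> disc_edges (cycle_edges L)"
      using subE unfolding region_jordan(6)[OF L] by (auto simp: disc_edges_def curve_def)
  qed
qed

end

section \<open>Chords and fans\<close>

lemma path_edges_ends:
  assumes "distinct (a # p @ [b])" "{a, b} \<in> path_edges (a # p @ [b])"
  shows "p = []"
proof (rule ccontr)
  assume "p \<noteq> []"
  then obtain x p' where p: "p = x # p'" by (cases p) auto
  have "\<Union>(path_edges (x # p' @ [b])) \<subseteq> set (x # p' @ [b])" by (rule Union_path_edges_subset)
  then have "{a, b} \<notin> path_edges (x # p' @ [b])" using assms(1) p by auto
  then show False using assms p by (auto simp: doubleton_eq_iff)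
qed

lemma cycle_edges_split:
  "cycle_edges (a # p @ b # q) = path_edges (a # p @ [b]) \<union> path_edges (a # rev q @ [b])"
  using path_edges_append[of "a # p" b "q @ [a]"] path_edges_rev[of "b # q @ [a]"]
  by (simp add: cycle_edges_Cons)

context plane_graph
begin

lemma cycle_avoids_region:
  assumes "is_cycle E L" "z \<in> set L"
  shows "z \<notin> region (cycle_edges L)"
proof -
  have "z \<in> \<Union>(cycle_edges L)" using assms(2) by (simp only: Union_cycle_edges)
  then have "z \<in> curve (cycle_edges L)"
    using curve_vertices[of "cycle_edges L"] assms(1) by (auto simp: is_cycle_def)
  then show ?thesis using region_disjoint by blast
qed

lemma cycle_vertices: "is_cycle E L \<Longrightarrow> set L \<subseteq> V"
  using edge_subset Union_cycle_edges[of L] unfolding is_cycle_def by blast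

lemma Union_disc_edges_cycle:
  "is_cycle E L \<Longrightarrow> \<Union>(disc_edges (cycle_edges L)) \<subseteq> set L \<union> (V \<inter> region (cycle_edges L))"
  using Union_disc_edges[of "cycle_edges L"] Union_cycle_edges[of L] by (simp add: is_cycle_def)

text \<open>A common edge has its ends among the common vertices \<open>a\<close> and
  \<open>b\<close>. It then joins the ends of both paths, so each path would consist of this edge
  alone.\<close>

lemma path_edges_disjoint:
  assumes "distinct (a # p @ [b])" "distinct (a # q @ [b])" "set p \<inter> set q = {}"
    and "path_edges (a # p @ [b]) \<subseteq> E" "p \<noteq> [] \<or> q \<noteq> []"
  shows "path_edges (a # p @ [b]) \<inter> path_edges (a # q @ [b]) = {}"
proof (rule ccontr)
  assume "path_edges (a # p @ [b]) \<inter> path_edges (a # q @ [b]) \<noteq> {}"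
  then obtain e where e: "e \<in> path_edges (a # p @ [b])" "e \<in> path_edges (a # q @ [b])" by blast
  have "e \<subseteq> set (a # p @ [b]) \<inter> set (a # q @ [b])"
    using e Union_path_edges_subset[of "a # p @ [b]"] Union_path_edges_subset[of "a # q @ [b]"] by blast
  also have "\<dots> \<subseteq> {a, b}" using assms(3) by auto
  finally have "e \<subseteq> {a, b}" .
  moreover have "card e = 2" using e(1) assms(4) edge_card by blast
  moreover have "card {a, b} = 2" using assms(1) by simp
  ultimately have "e = {a, b}" by (intro card_subset_eq) simp_all
  then have "p = []" "q = []"
    using e path_edges_ends[OF assms(1)] path_edges_ends[OF assms(2)] by simp_all
  then show False using assms(5) by simp
qed

text \<open>The paths through \<open>p\<close>, through the reverse of \<open>q\<close> and through
  \<open>c\<close> form a theta curve from \<open>a\<close> to \<open>b\<close>. Condition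
  \<open>new\<close> keeps a chord from repeating a boundary edge. It is applied to a chord, with
  \<open>c = []\<close>, and to a path through one interior vertex.\<close>

lemma cut_cycle:
  assumes L: "is_cycle E (a # p @ b # q)"
    and c: "distinct c" "set c \<inter> set (a # p @ b # q) = {}" "path_edges (a # c @ [b]) \<subseteq> E"
    and new: "c = [] \<Longrightarrow> {a, b} \<notin> cycle_edges (a # p @ b # q)"
    and inside: "curve (path_edges (a # c @ [b])) \<inter> region (cycle_edges (a # p @ b # q)) \<noteq> {}"
  defines "L1 \<equiv> a # p @ b # rev c" and "L2 \<equiv> a # c @ b # q"
  shows "is_cycle E L1" "is_cycle E L2"
    "disc_edges (cycle_edges (a # p @ b # q)) = disc_edges (cycle_edges L1) \<union> disc_edges (cycle_edges L2)"
    "disc_edges (cycle_edges L1) \<inter> disc_edges (cycle_edges L2) = path_edges (a # c @ [b])"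
    "region (cycle_edges L1) \<subseteq> region (cycle_edges (a # p @ b # q))"
    "region (cycle_edges L2) \<subseteq> region (cycle_edges (a # p @ b # q))"
    "region (cycle_edges L1) \<inter> region (cycle_edges L2) = {}"
    "V \<inter> region (cycle_edges (a # p @ b # q)) =
      (V \<inter> region (cycle_edges L1)) \<union> (V \<inter> region (cycle_edges L2)) \<union> set c"
proof -
  let ?P = "a # p @ [b]" and ?Q = "a # rev q @ [b]" and ?C = "a # c @ [b]"
  let ?L = "a # p @ b # q"
  have eL: "cycle_edges ?L = path_edges ?P \<union> path_edges ?Q" by (rule cycle_edges_split)
  have e1: "cycle_edges L1 = path_edges ?P \<union> path_edges ?C"
    using cycle_edges_split[of a p b "rev c"] by (simp add: L1_def)
  have e2: "cycle_edges L2 = path_edges ?Q \<union> path_edges ?C"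
    using cycle_edges_split[of a c b q] by (simp add: L2_def Un_commute)
  have dist: "distinct ?L" and len: "3 \<le> length ?L" and sub: "path_edges ?P \<subseteq> E" "path_edges ?Q \<subseteq> E"
    using L eL by (auto simp: is_cycle_def)
  have dP: "distinct ?P" and dQ: "distinct ?Q" and dC: "distinct ?C" using dist c by auto
  have "a \<noteq> b" using dist by simp
  have pc: "p \<noteq> [] \<or> c \<noteq> []" and qc: "q \<noteq> [] \<or> c \<noteq> []"
    using new unfolding eL by auto
  have pq: "p \<noteq> [] \<or> q \<noteq> []" using len by auto
  have disj: "path_edges ?P \<inter> path_edges ?Q = {}" "path_edges ?P \<inter> path_edges ?C = {}"
    "path_edges ?Q \<inter> path_edges ?C = {}"
    using path_edges_disjoint[OF dP dQ _ sub(1)] path_edges_disjoint[OF dP dC _ sub(1) pc]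
      path_edges_disjoint[OF dQ dC _ sub(2)] pq qc dist c(2) by auto
  have meet: "set ?P \<inter> set ?Q = {a, b}" "set ?P \<inter> set ?C = {a, b}" "set ?Q \<inter> set ?C = {a, b}"
    using dist c(2) by auto
  have chord: "curve (path_edges ?C) \<inter> region (path_edges ?P \<union> path_edges ?Q) \<noteq> {}"
    using inside unfolding eL .
  have "2 \<le> length ?P" "2 \<le> length ?Q" "2 \<le> length ?C"
    "hd ?P = a" "last ?P = b" "hd ?Q = a" "last ?Q = b" "hd ?C = a" "last ?C = b" by simp_all
  note theta = theta_interiors[OF dP dQ dC this(1-3) sub c(3) this(4-9) \<open>a \<noteq> b\<close> meet disj chord]
  show cyc1: "is_cycle E L1"
    using dist c pc sub(1) e1 by (auto simp: is_cycle_def L1_def Suc_le_eq numeral_3_eq_3)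
  show cyc2: "is_cycle E L2"
    using dist c qc sub(2) e2 by (auto simp: is_cycle_def L2_def Suc_le_eq numeral_3_eq_3)
  note J1 = region_jordan[OF cyc1, unfolded e1] and J2 = region_jordan[OF cyc2, unfolded e2]
  have "{a, b} \<subseteq> V" using cycle_vertices[OF L] by auto
  note D = theta_disc_edges[OF sub c(3) J1(1) J2(1) J1(6) J2(6) theta this]
  show "disc_edges (cycle_edges ?L) = disc_edges (cycle_edges L1) \<union> disc_edges (cycle_edges L2)"
    "disc_edges (cycle_edges L1) \<inter> disc_edges (cycle_edges L2) = path_edges (a # c @ [b])"
    unfolding eL e1 e2 using D by blast+
  show "region (cycle_edges L1) \<subseteq> region (cycle_edges ?L)"
    "region (cycle_edges L2) \<subseteq> region (cycle_edges ?L)"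
    "region (cycle_edges L1) \<inter> region (cycle_edges L2) = {}"
    unfolding eL e1 e2 using theta by blast+
  \<comment> \<open>The inner vertices of the cutting path are interior for the old cycle but lie on
    both new ones; hence the extra \<open>set c\<close>.\<close>
  have "V \<inter> curve (path_edges ?C) = set ?C"
    using curve_vertices[OF c(3)] Union_path_edges[of ?C] by auto
  moreover have "a \<notin> set c" "b \<notin> set c" using c(2) by auto
  ultimately have "V \<inter> (curve (path_edges ?C) - {a, b}) = set c" by auto
  then show "V \<inter> region (cycle_edges ?L) =
      (V \<inter> region (cycle_edges L1)) \<union> (V \<inter> region (cycle_edges L2)) \<union> set c"
    unfolding eL e1 e2 using theta(2) by blast
qed

lemma chord_inside:
  assumes "is_cycle E L" "e \<in> disc_edges (cycle_edges L)" "e \<notin> cycle_edges L"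
  shows "curve {e} \<inter> region (cycle_edges L) \<noteq> {}"
proof -
  have "e \<in> E" using assms(2) disc_edges_subset by blast
  moreover have "open_edge e \<subseteq> region (cycle_edges L)"
    using open_edge_subset_region[OF _ assms(2,3)] assms(1) by (simp add: is_cycle_def)
  moreover have "open_edge e \<subseteq> curve {e}" by (auto simp: open_edge_def curve_def)
  ultimately show ?thesis using open_edge_nonempty by blast
qed

lemma finite_disc_edges: "finite (disc_edges S)"
  using finite_edges disc_edges_subset by (rule rev_finite_subset)

lemma cut_cycle_edge:
  assumes L: "is_cycle E (a # p @ b # q)" and ab: "{a, b} \<in> disc_edges (cycle_edges (a # p @ b # q))"
    and "p \<noteq> []" "q \<noteq> []"
  shows "{a, b} \<notin> cycle_edges (a # p @ b # q)" "is_cycle E (a # p @ [b])" "is_cycle E (a # b # q)"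
    "disc_edges (cycle_edges (a # p @ b # q)) =
      disc_edges (cycle_edges (a # p @ [b])) \<union> disc_edges (cycle_edges (a # b # q))"
    "disc_edges (cycle_edges (a # p @ [b])) \<inter> disc_edges (cycle_edges (a # b # q)) = {{a, b}}"
    "region (cycle_edges (a # p @ [b])) \<subseteq> region (cycle_edges (a # p @ b # q))"
    "region (cycle_edges (a # b # q)) \<subseteq> region (cycle_edges (a # p @ b # q))"
    "region (cycle_edges (a # p @ [b])) \<inter> region (cycle_edges (a # b # q)) = {}"
    "V \<inter> region (cycle_edges (a # p @ b # q)) =
      (V \<inter> region (cycle_edges (a # p @ [b]))) \<union> (V \<inter> region (cycle_edges (a # b # q)))"
proof -
  have dist: "distinct (a # p @ b # q)" using L by (simp add: is_cycle_def)
  then have d: "distinct (a # p @ [b])" "distinct (a # rev q @ [b])" by auto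
  show new: "{a, b} \<notin> cycle_edges (a # p @ b # q)"
    unfolding cycle_edges_split
    using path_edges_ends[OF d(1)] path_edges_ends[OF d(2)] assms(3,4) by auto
  have sub: "path_edges (a # [] @ [b]) \<subseteq> E" using ab disc_edges_subset by auto
  have ne: "curve (path_edges (a # [] @ [b])) \<inter> region (cycle_edges (a # p @ b # q)) \<noteq> {}"
    using chord_inside[OF L ab new] by simp
  note cut = cut_cycle[OF L _ _ sub new ne, unfolded rev.simps(1) append_Nil path_edges.simps, simplified]
  show "is_cycle E (a # p @ [b])" "is_cycle E (a # b # q)"
    "disc_edges (cycle_edges (a # p @ b # q)) =
      disc_edges (cycle_edges (a # p @ [b])) \<union> disc_edges (cycle_edges (a # b # q))"
    "disc_edges (cycle_edges (a # p @ [b])) \<inter> disc_edges (cycle_edges (a # b # q)) = {{a, b}}"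
    "region (cycle_edges (a # p @ [b])) \<subseteq> region (cycle_edges (a # p @ b # q))"
    "region (cycle_edges (a # b # q)) \<subseteq> region (cycle_edges (a # p @ b # q))"
    "region (cycle_edges (a # p @ [b])) \<inter> region (cycle_edges (a # b # q)) = {}"
    "V \<inter> region (cycle_edges (a # p @ b # q)) =
      (V \<inter> region (cycle_edges (a # p @ [b]))) \<union> (V \<inter> region (cycle_edges (a # b # q)))"
    by (fact cut)+
qed

text \<open>The path from \<open>a\<close> over \<open>w\<close> to \<open>v\<close> cuts off the
  triangle at \<open>{a, v}\<close>. The remaining cycle is rotated to begin with \<open>w\<close>,
  which thus takes over the role of \<open>a\<close> for the next triangle at
  \<open>v\<close>.\<close>

lemma cut_cycle_vertex:
  assumes L: "is_cycle E (a # p @ [v])" and w: "w \<in> V" "w \<in> region (cycle_edges (a # p @ [v]))"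
    and "{a, w} \<in> E" "{w, v} \<in> E"
  shows "is_cycle E (w # a # p @ [v])"
    "disc_edges (cycle_edges (a # p @ [v])) =
      disc_edges (cycle_edges (w # a # p @ [v])) \<union> disc_edges (cycle_edges [a, v, w])"
    "disc_edges (cycle_edges (w # a # p @ [v])) \<inter> disc_edges (cycle_edges [a, v, w]) = {{a, w}, {w, v}}"
    "V \<inter> region (cycle_edges (a # p @ [v])) =
      (V \<inter> region (cycle_edges (w # a # p @ [v]))) \<union> (V \<inter> region (cycle_edges [a, v, w])) \<union> {w}"
proof -
  have sub: "path_edges (a # [w] @ [v]) \<subseteq> E" using assms(4,5) by simp
  have wL: "set [w] \<inter> set (a # p @ v # []) = {}"
    using cycle_avoids_region[OF L, of w] w(2) by auto
  have "w \<in> curve (path_edges (a # [w] @ [v]))"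
    using curve_vertices[OF sub] by auto
  then have ne: "curve (path_edges (a # [w] @ [v])) \<inter> region (cycle_edges (a # p @ v # [])) \<noteq> {}"
    using w(2) by blast
  have dw: "distinct [w]" by simp
  have imp: "[w] = [] \<Longrightarrow> {a, v} \<notin> cycle_edges (a # p @ v # [])" by simp
  have rot: "cycle_edges (w # a # p @ [v]) = cycle_edges (a # p @ v # rev [w])"
    using cycle_edges_rotate[of "[w]" "a # p @ [v]"] by simp
  have tri: "cycle_edges [a, v, w] = cycle_edges (a # [w] @ v # [])"
    by (auto simp: cycle_edges_Cons)
  note cut = cut_cycle[OF L dw wL sub imp ne]
  show "is_cycle E (w # a # p @ [v])"
    using cut(1) is_cycle_rotate[of E "[w]" "a # p @ [v]"] by simp
  show "disc_edges (cycle_edges (a # p @ [v])) =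
      disc_edges (cycle_edges (w # a # p @ [v])) \<union> disc_edges (cycle_edges [a, v, w])"
    unfolding rot tri using cut(3) by simp
  show "disc_edges (cycle_edges (w # a # p @ [v])) \<inter> disc_edges (cycle_edges [a, v, w]) = {{a, w}, {w, v}}"
    unfolding rot tri using cut(4) by simp
  show "V \<inter> region (cycle_edges (a # p @ [v])) =
      (V \<inter> region (cycle_edges (w # a # p @ [v]))) \<union> (V \<inter> region (cycle_edges [a, v, w])) \<union> {w}"
    unfolding rot tri using cut(8) by simp
qed

end

context near_triangulation
begin

text \<open>
  The triangles at \<open>v\<close> are peeled off one by one, starting at the edge from \<open>v\<close> to the first vertex
  of \<open>Q\<close>; the third vertices of the triangles are collected in \<open>us\<close>.
\<close>

lemma remove_chordless_vertex:
  assumes "is_cycle E (a # Q @ [v])" "last (a # Q) = b"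
    and "\<And>w. w \<in> set Q \<Longrightarrow> {v, w} \<in> disc_edges (cycle_edges (a # Q @ [v])) \<Longrightarrow> w = b"
  shows "(Q = [b] \<and> disc_edges (cycle_edges (a # Q @ [v])) = {{a, b}, {v, a}, {v, b}} \<and>
      V \<inter> region (cycle_edges (a # Q @ [v])) = {}) \<or>
    (\<exists>us. is_cycle E (a # Q @ us) \<and>
      V \<inter> region (cycle_edges (a # Q @ [v])) = (V \<inter> region (cycle_edges (a # Q @ us))) \<union> set us \<and>
      v \<notin> \<Union>(disc_edges (cycle_edges (a # Q @ us))) \<and>
      disc_edges (cycle_edges (a # Q @ [v])) =
        insert {v, a} (insert {v, b} (disc_edges (cycle_edges (a # Q @ us)) \<union> (\<lambda>u. {v, u}) ` set us)))"
  using assms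
proof (induction "card (disc_edges (cycle_edges (a # Q @ [v])))" arbitrary: Q a rule: less_induct)
  case (less Q a)
  let ?L = "a # Q @ [v]"
  note L = less.prems(1)
  have dist: "distinct ?L" and len: "Q \<noteq> []" using L by (auto simp: is_cycle_def)
  have va: "{a, v} \<in> cycle_edges ?L"
    using path_edges_append[of "a # Q" v "[a]"] by (simp add: cycle_edges_Cons insert_commute)
  obtain w where T: "is_cycle E [a, v, w]" "disc_edges (cycle_edges [a, v, w]) = cycle_edges [a, v, w]"
    "region (cycle_edges [a, v, w]) \<inter> V = {}" "cycle_edges [a, v, w] \<subseteq> disc_edges (cycle_edges ?L)"
    by (rule triangle_at_edge[OF L va])
  have tri: "cycle_edges [a, v, w] = {{v, a}, {v, w}, {a, w}}"
    by (auto simp: cycle_edges_Cons)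
  have DT2: "disc_edges (cycle_edges [a, v, w]) = {{v, a}, {v, w}, {a, w}}"
    using T(2) tri by (rule trans)
  have DT: "{v, a} \<in> disc_edges (cycle_edges ?L)" "{v, w} \<in> disc_edges (cycle_edges ?L)"
    "{a, w} \<in> disc_edges (cycle_edges ?L)" using T(4) unfolding tri by blast+
  have w: "w \<noteq> a" "w \<noteq> v" using T(1) by (auto simp: is_cycle_def)
  have v_boundary: "v \<notin> region (cycle_edges ?L)" using cycle_avoids_region[OF L] by simp
  show ?case
  proof (cases "w \<in> set Q")
    case True
    \<comment> \<open>The last triangle at \<open>v\<close> is reached. Either it is the whole disc,
      or \<open>{a, b}\<close> is a chord and the new disc is its other side, with no vertices left
      to collect.\<close>
    then have wb: "w = b" using less.prems(3)[of w] DT(2) by blast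
    have triE: "cycle_edges [a, b, v] = cycle_edges [a, v, w]"
      unfolding wb by (auto simp: cycle_edges_Cons)
    have DabV: "disc_edges (cycle_edges [a, b, v]) = {{a, b}, {v, a}, {v, b}}"
      unfolding triE DT2 unfolding wb by blast
    have RabV: "V \<inter> region (cycle_edges [a, b, v]) = {}"
      unfolding triE using T(3) by blast
    show ?thesis
    proof (cases "Q = [b]")
      case True
      then have "a # Q @ [v] = [a, b, v]" by simp
      then show ?thesis using DabV RabV True by (intro disjI1 conjI) (simp_all only:)
    next
      case False
      have last: "last Q = b" using less.prems(2) len by simp
      have "butlast Q @ [last Q] = Q" using len by (rule append_butlast_last_id)
      then have "Q = butlast Q @ [b]" unfolding last by (rule sym)
      then obtain Q1 where Q1: "Q = Q1 @ [b]" by (rule that)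
      then have "Q1 \<noteq> []" using False by auto
      have Lq: "?L = a # Q1 @ b # [v]" and Qq: "a # Q = a # Q1 @ [b]" using Q1 by simp_all
      note cut = cut_cycle_edge[of a Q1 b "[v]", folded Lq Qq]
      note cut = cut[OF L DT(3)[unfolded wb] \<open>Q1 \<noteq> []\<close> not_Cons_self2]
      have "v \<notin> set (a # Q)" using dist by auto
      moreover have "v \<notin> region (cycle_edges (a # Q))" using cut(6) v_boundary by blast
      ultimately have "v \<notin> \<Union>(disc_edges (cycle_edges (a # Q)))"
        using Union_disc_edges_cycle[OF cut(2)] by blast
      moreover have "disc_edges (cycle_edges ?L) = insert {v, a} (insert {v, b} (disc_edges (cycle_edges (a # Q))))"
        using cut(4,5) unfolding DabV by blast
      moreover have "V \<inter> region (cycle_edges ?L) = V \<inter> region (cycle_edges (a # Q))"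
        using cut(9) unfolding RabV by blast
      ultimately show ?thesis using cut(2) by (intro disjI2 exI[of _ "[]"]) simp
    qed
  next
    case False
    then have wL: "w \<notin> set ?L" using w by simp
    have "w \<in> \<Union>(disc_edges (cycle_edges ?L))" using DT(2) by blast
    then have wR: "w \<in> V" "w \<in> region (cycle_edges ?L)"
      using Union_disc_edges_cycle[OF L] wL by blast+
    have "{v, w} \<in> E" using DT(2) disc_edges_subset by blast
    then have wE: "{a, w} \<in> E" "{w, v} \<in> E"
      using DT(3) disc_edges_subset by (blast, simp add: insert_commute)
    note cut = cut_cycle_vertex[OF L wR wE]
    have va_out: "{v, a} \<notin> disc_edges (cycle_edges (w # a # Q @ [v]))"
    proof
      assume "{v, a} \<in> disc_edges (cycle_edges (w # a # Q @ [v]))"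
      then have "{v, a} \<in> disc_edges (cycle_edges (w # a # Q @ [v])) \<inter> disc_edges (cycle_edges [a, v, w])"
        unfolding DT2 by simp
      then have "{v, a} \<in> {{a, w}, {w, v}}" unfolding cut(3) .
      then show False using w dist by (simp add: doubleton_eq_iff)
    qed
    have smaller: "card (disc_edges (cycle_edges (w # (a # Q) @ [v]))) < card (disc_edges (cycle_edges ?L))"
    proof (rule psubset_card_mono[OF finite_disc_edges])
      have "disc_edges (cycle_edges (w # (a # Q) @ [v])) \<subseteq> disc_edges (cycle_edges ?L)"
        unfolding cut(2) append_Cons by (rule Un_upper1)
      moreover have "disc_edges (cycle_edges (w # (a # Q) @ [v])) \<noteq> disc_edges (cycle_edges ?L)"
        using va_out DT(1) by auto
      ultimately show "disc_edges (cycle_edges (w # (a # Q) @ [v])) \<subset> disc_edges (cycle_edges ?L)"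
        by (rule psubsetI)
    qed
    have nochord: "x = b" if x: "x \<in> set (a # Q)" "{v, x} \<in> disc_edges (cycle_edges (w # (a # Q) @ [v]))" for x
    proof -
      \<comment> \<open>The vertex \<open>a\<close> has joined the list, but its edge to
        \<open>v\<close> went away with the triangle, so it creates no chord at
        \<open>v\<close>.\<close>
      have "x \<noteq> a" using x(2) va_out unfolding append_Cons by blast
      then have "x \<in> set Q" using x(1) by simp
      moreover have "{v, x} \<in> disc_edges (cycle_edges ?L)"
        using x(2) cut(2) unfolding append_Cons by blast
      ultimately show ?thesis by (rule less.prems(3))
    qed
    have "is_cycle E (w # (a # Q) @ [v])" "last (w # a # Q) = b" using cut(1) less.prems(2) by simp_all
    note IH = less.hyps[OF smaller this nochord]
    \<comment> \<open>This excludes the first alternative of the induction hypothesis.\<close>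
    have "a # Q \<noteq> [b]" using len by simp
    with IH have "\<exists>us. is_cycle E (w # a # Q @ us) \<and>
      V \<inter> region (cycle_edges (w # a # Q @ [v])) = (V \<inter> region (cycle_edges (w # a # Q @ us))) \<union> set us \<and>
      v \<notin> \<Union>(disc_edges (cycle_edges (w # a # Q @ us))) \<and>
      disc_edges (cycle_edges (w # a # Q @ [v])) =
        insert {v, w} (insert {v, b} (disc_edges (cycle_edges (w # a # Q @ us)) \<union> (\<lambda>u. {v, u}) ` set us))"
      by (simp only: append_Cons simp_thms)
    then obtain us where us: "is_cycle E (w # a # Q @ us)"
      "V \<inter> region (cycle_edges (w # a # Q @ [v])) = (V \<inter> region (cycle_edges (w # a # Q @ us))) \<union> set us"
      "v \<notin> \<Union>(disc_edges (cycle_edges (w # a # Q @ us)))"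
      "disc_edges (cycle_edges (w # a # Q @ [v])) =
        insert {v, w} (insert {v, b} (disc_edges (cycle_edges (w # a # Q @ us)) \<union> (\<lambda>u. {v, u}) ` set us))"
      by (elim exE conjE)
    \<comment> \<open>Rotation moves \<open>w\<close> from the front of the cycle to its end, behind
      the vertices collected so far.\<close>
    have rot: "cycle_edges (w # a # Q @ us) = cycle_edges (a # Q @ us @ [w])"
      "is_cycle E (w # a # Q @ us) = is_cycle E (a # Q @ us @ [w])"
      using cycle_edges_rotate[of "[w]" "a # Q @ us"] is_cycle_rotate[of E "[w]" "a # Q @ us"] by simp_all
    have wa: "{a, w} \<in> disc_edges (cycle_edges (w # a # Q @ us))"
    proof -
      have "{a, w} \<in> cycle_edges (w # a # Q @ us)" by (simp add: cycle_edges_Cons insert_commute)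
      moreover have "cycle_edges (w # a # Q @ us) \<subseteq> E" using us(1) by (simp add: is_cycle_def)
      ultimately show ?thesis using boundary_subset_disc_edges by blast
    qed
    have star: "(\<lambda>u. {v, u}) ` set (us @ [w]) = insert {v, w} ((\<lambda>u. {v, u}) ` set us)" by simp
    \<comment> \<open>The third side \<open>{a, w}\<close> of the removed triangle adds nothing: it
      is a boundary edge of the remaining disc.\<close>
    have D: "disc_edges (cycle_edges ?L) =
        insert {v, a} (insert {v, b} (disc_edges (cycle_edges (w # a # Q @ us)) \<union> (\<lambda>u. {v, u}) ` set (us @ [w])))"
      unfolding cut(2) us(4) DT2 star using wa by blast
    have R: "V \<inter> region (cycle_edges ?L) = (V \<inter> region (cycle_edges (w # a # Q @ us))) \<union> set (us @ [w])"
      unfolding cut(4) us(2) using T(3) by auto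
    show ?thesis
    proof (rule disjI2, rule exI[of _ "us @ [w]"], intro conjI)
      show "is_cycle E (a # Q @ us @ [w])" using us(1) unfolding rot .
      show "v \<notin> \<Union>(disc_edges (cycle_edges (a # Q @ us @ [w])))" using us(3) unfolding rot .
    qed (fact R[unfolded rot] D[unfolded rot])+
  qed
qed

end

section \<open>Nice outdegrees inside a cycle\<close>

context plane_graph
begin

text \<open>The induction invariant for a cycle rooted at its edge \<open>{x, y}\<close>, stated for
  exponents. The smaller bound on the cycle leaves a reserve of two for vertices that become
  interior in a larger disc.\<close>

definition nice_tails ::
    "(complex set \<Rightarrow> complex \<Rightarrow> int) \<Rightarrow> complex \<Rightarrow> complex \<Rightarrow> complex list \<Rightarrow> complex multiset \<Rightarrow> bool" where
  "nice_tails s x y P M \<longleftrightarrow>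
     orient_coeff s (disc_edges (cycle_edges (x # y # P)) - {{x, y}}) M \<noteq> 0 \<and>
     count M x = 0 \<and> count M y = 0 \<and> (\<forall>z\<in>set P. count M z \<le> 2) \<and>
     (\<forall>z\<in>V \<inter> region (cycle_edges (x # y # P)). count M z \<le> 4)"

lemma nice_tails_support:
  assumes "is_cycle E (x # y # P)" "nice_tails s x y P M"
  shows "set_mset M \<subseteq> set P \<union> (V \<inter> region (cycle_edges (x # y # P)))"
proof
  fix z assume z: "z \<in># M"
  have "orient_coeff s (disc_edges (cycle_edges (x # y # P)) - {{x, y}}) M \<noteq> 0"
    using assms(2) by (simp add: nice_tails_def)
  then have "z \<in> \<Union>(disc_edges (cycle_edges (x # y # P)) - {{x, y}})"
    using orient_coeff_nonzero(2) z by blast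
  then have "z \<in> set (x # y # P) \<union> (V \<inter> region (cycle_edges (x # y # P)))"
    using Union_disc_edges_cycle[OF assms(1)] by blast
  moreover have "x \<notin># M" "y \<notin># M" using assms(2) by (simp_all add: nice_tails_def count_eq_zero_iff)
  then have "z \<noteq> x" "z \<noteq> y" using z by auto
  ultimately show "z \<in> set P \<union> (V \<inter> region (cycle_edges (x # y # P)))" by simp
qed

text \<open>Rotation brings \<open>v\<close> to the front, so that the general cut along an edge
  applies. The second cycle is listed from \<open>v\<close> and \<open>w\<close>, which makes the
  chord its root edge.\<close>

lemma cut_at_chord:
  assumes L: "is_cycle E (x # y # P @ B @ [v])" and w: "last (y # P) = w" and "B \<noteq> []"
    and vw: "{v, w} \<in> disc_edges (cycle_edges (x # y # P @ B @ [v]))"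
  shows "{v, w} \<notin> cycle_edges (x # y # P @ B @ [v])"
    "is_cycle E (x # y # P @ [v])" "is_cycle E (v # w # B)"
    "disc_edges (cycle_edges (x # y # P @ B @ [v])) =
      disc_edges (cycle_edges (x # y # P @ [v])) \<union> disc_edges (cycle_edges (v # w # B))"
    "disc_edges (cycle_edges (x # y # P @ [v])) \<inter> disc_edges (cycle_edges (v # w # B)) = {{v, w}}"
    "region (cycle_edges (x # y # P @ [v])) \<subseteq> region (cycle_edges (x # y # P @ B @ [v]))"
    "region (cycle_edges (v # w # B)) \<subseteq> region (cycle_edges (x # y # P @ B @ [v]))"
    "region (cycle_edges (x # y # P @ [v])) \<inter> region (cycle_edges (v # w # B)) = {}"
    "V \<inter> region (cycle_edges (x # y # P @ B @ [v])) =
      (V \<inter> region (cycle_edges (x # y # P @ [v]))) \<union> (V \<inter> region (cycle_edges (v # w # B)))"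
proof -
  define A where "A = butlast (y # P)"
  have A: "y # P = A @ [w]" unfolding A_def w[symmetric] by (rule append_butlast_last_id[symmetric]) simp
  have PB: "x # y # P @ B @ [v] = (x # A @ w # B) @ [v]" and P: "x # y # P @ [v] = (x # A @ [w]) @ [v]"
    using A by simp_all
  have rot: "cycle_edges (x # y # P @ B @ [v]) = cycle_edges (v # (x # A) @ w # B)"
    "cycle_edges (x # y # P @ [v]) = cycle_edges (v # (x # A) @ [w])"
    unfolding PB P by (subst cycle_edges_rotate; simp)+
  have cyc: "is_cycle E (x # y # P @ B @ [v]) = is_cycle E (v # (x # A) @ w # B)"
    "is_cycle E (x # y # P @ [v]) = is_cycle E (v # (x # A) @ [w])"
    unfolding PB P by (subst is_cycle_rotate; simp)+
  have "x # A \<noteq> []" by simp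
  note cut = cut_cycle_edge[OF L[unfolded cyc] vw[unfolded rot] this \<open>B \<noteq> []\<close>]
  show "{v, w} \<notin> cycle_edges (x # y # P @ B @ [v])"
    "is_cycle E (x # y # P @ [v])" "is_cycle E (v # w # B)"
    "disc_edges (cycle_edges (x # y # P @ B @ [v])) =
      disc_edges (cycle_edges (x # y # P @ [v])) \<union> disc_edges (cycle_edges (v # w # B))"
    "disc_edges (cycle_edges (x # y # P @ [v])) \<inter> disc_edges (cycle_edges (v # w # B)) = {{v, w}}"
    "region (cycle_edges (x # y # P @ [v])) \<subseteq> region (cycle_edges (x # y # P @ B @ [v]))"
    "region (cycle_edges (v # w # B)) \<subseteq> region (cycle_edges (x # y # P @ B @ [v]))"
    "region (cycle_edges (x # y # P @ [v])) \<inter> region (cycle_edges (v # w # B)) = {}"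
    "V \<inter> region (cycle_edges (x # y # P @ B @ [v])) =
      (V \<inter> region (cycle_edges (x # y # P @ [v]))) \<union> (V \<inter> region (cycle_edges (v # w # B)))"
    unfolding rot cyc by (fact cut)+
qed

text \<open>The chord is kept in the first disc and omitted as root edge in the second. So
  \<open>M2\<close> vanishes at \<open>v\<close> and \<open>w\<close>, its support misses every edge
  of the first disc, and the coefficients multiply. No vertex has positive count in both
  \<open>M1\<close> and \<open>M2\<close>, so the bounds survive.\<close>

lemma nice_tails_glue:
  assumes L: "is_cycle E (x # y # P @ B @ [v])" and w: "last (y # P) = w" and "B \<noteq> []"
    and vw: "{v, w} \<in> disc_edges (cycle_edges (x # y # P @ B @ [v]))"
    and M1: "nice_tails s x y (P @ [v]) M1" and M2: "nice_tails s v w B M2"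
  shows "nice_tails s x y (P @ B @ [v]) (M1 + M2)"
proof -
  note cut = cut_at_chord[OF L w \<open>B \<noteq> []\<close> vw]
  define D R where "D = disc_edges (cycle_edges (x # y # P @ B @ [v]))"
    and "R = region (cycle_edges (x # y # P @ B @ [v]))"
  define D1 R1 where "D1 = disc_edges (cycle_edges (x # y # P @ [v]))"
    and "R1 = region (cycle_edges (x # y # P @ [v]))"
  define D2 R2 where "D2 = disc_edges (cycle_edges (v # w # B))"
    and "R2 = region (cycle_edges (v # w # B))"
  note defs = D_def[symmetric] R_def[symmetric] D1_def[symmetric] R1_def[symmetric] D2_def[symmetric] R2_def[symmetric]
  note cut = cut[unfolded defs]
  have xy: "{x, y} \<in> cycle_edges (x # y # P @ B @ [v])" "{x, y} \<in> cycle_edges (x # y # P @ [v])"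
    by (simp_all add: cycle_edges_Cons)
  have "{x, y} \<noteq> {v, w}" using xy(1) cut(1) by metis
  have "cycle_edges (x # y # P @ [v]) \<subseteq> E" using cut(2) by (simp add: is_cycle_def)
  then have "{x, y} \<in> D1" using boundary_subset_disc_edges xy(2) unfolding D1_def by blast
  have DE: "D - {{x, y}} = (D1 - {{x, y}}) \<union> (D2 - {{v, w}})"
  proof -
    have "{x, y} \<notin> D2"
    proof
      assume "{x, y} \<in> D2"
      with \<open>{x, y} \<in> D1\<close> have "{x, y} \<in> D1 \<inter> D2" by simp
      then show False unfolding cut(5) using \<open>{x, y} \<noteq> {v, w}\<close> by simp
    qed
    moreover have "{v, w} \<in> D1 \<inter> D2" unfolding cut(5) by simp
    ultimately show ?thesis unfolding cut(4) using \<open>{x, y} \<noteq> {v, w}\<close> by auto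
  qed
  have disj: "(D1 - {{x, y}}) \<inter> (D2 - {{v, w}}) = {}" using cut(5) by blast
  have s1: "set_mset M1 \<subseteq> set (P @ [v]) \<union> (V \<inter> R1)"
    using nice_tails_support[OF cut(2) M1] unfolding R1_def .
  have s2: "set_mset M2 \<subseteq> set B \<union> (V \<inter> R2)"
    using nice_tails_support[OF cut(3) M2] unfolding R2_def .
  have dist: "distinct (x # y # P @ B @ [v])" using L by (simp add: is_cycle_def)
  have boundary: "z \<notin> R1" "z \<notin> R2" if "z \<in> set (x # y # P @ B @ [v])" for z
    using cycle_avoids_region[OF L that] cut(6,7) unfolding R_def by blast+
  have apart: "(set (x # y # P @ [v]) \<union> (V \<inter> R1)) \<inter> (set B \<union> (V \<inter> R2)) = {}"
  proof -
    have "set (x # y # P @ [v]) \<inter> set B = {}" using dist by auto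
    moreover have "set (x # y # P @ [v]) \<inter> R2 = {}" "R1 \<inter> set B = {}" using boundary by auto
    ultimately show ?thesis using cut(8) by blast
  qed
  have m1: "count M1 z = 0" if "z \<in> set B \<union> (V \<inter> R2)" for z
  proof -
    have "z \<notin> set (P @ [v]) \<union> (V \<inter> R1)" using that apart by auto
    then show ?thesis using s1 by (auto simp: count_eq_zero_iff)
  qed
  have m2: "count M2 z = 0" if "z \<in> set (x # y # P @ [v]) \<union> (V \<inter> R1)" for z
  proof -
    have "z \<notin> set B \<union> (V \<inter> R2)" using that apart by blast
    then show ?thesis using s2 by (auto simp: count_eq_zero_iff)
  qed
  have c1: "orient_coeff s (D1 - {{x, y}}) M1 \<noteq> 0" and c2: "orient_coeff s (D2 - {{v, w}}) M2 \<noteq> 0"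
    using M1 M2 by (simp_all add: nice_tails_def defs)
  have "orient_coeff s ((D1 - {{x, y}}) \<union> (D2 - {{v, w}})) (M1 + M2) =
      orient_coeff s (D1 - {{x, y}}) M1 * orient_coeff s (D2 - {{v, w}}) M2"
  proof (rule orient_coeff_union[OF _ _ disj])
    show "finite (D1 - {{x, y}})" "finite (D2 - {{v, w}})"
      unfolding D1_def D2_def using finite_disc_edges by auto
    show "e \<inter> set_mset M2 = {}" if "e \<in> D1 - {{x, y}}" for e
    proof -
      have "e \<subseteq> set (x # y # P @ [v]) \<union> (V \<inter> R1)"
        using that Union_disc_edges_cycle[OF cut(2)] unfolding defs by blast
      then show ?thesis using s2 apart by blast
    qed
    show "size M2 = card (D2 - {{v, w}})" using orient_coeff_nonzero(1)[OF c2] .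
  qed
  then have "orient_coeff s (D - {{x, y}}) (M1 + M2) \<noteq> 0"
    unfolding DE using c1 c2 by simp
  moreover have "count (M1 + M2) x = 0" "count (M1 + M2) y = 0"
    using M1 m2[of x] m2[of y] by (simp_all add: nice_tails_def)
  moreover have "count (M1 + M2) z \<le> 2" if z: "z \<in> set (P @ B @ [v])" for z
  proof (cases "z \<in> set B")
    case True
    then show ?thesis using M2 m1[of z] by (simp add: nice_tails_def)
  next
    case False
    then have "z \<in> set (P @ [v])" using z by auto
    then show ?thesis using M1 m2[of z] by (auto simp: nice_tails_def)
  qed
  moreover have "count (M1 + M2) z \<le> 4" if z: "z \<in> V \<inter> R" for z
  proof (cases "z \<in> V \<inter> R1")
    case True
    then show ?thesis using M1 m2[of z] by (simp add: nice_tails_def defs)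
  next
    case False
    then have "z \<in> V \<inter> R2" using z unfolding cut(9) by blast
    then show ?thesis using M2 m1[of z] by (simp add: nice_tails_def defs)
  qed
  ultimately show ?thesis by (simp add: nice_tails_def defs)
qed

lemma nice_tails_add_vertex:
  assumes L: "is_cycle E (x # y # P @ [v])" and L': "is_cycle E (x # y # P @ us)"
    and nz: "\<And>e z. s e z \<noteq> 0" and b: "last (y # P) = b"
    and R: "V \<inter> region (cycle_edges (x # y # P @ [v])) =
      (V \<inter> region (cycle_edges (x # y # P @ us))) \<union> set us"
    and v: "v \<notin> \<Union>(disc_edges (cycle_edges (x # y # P @ us)))"
    and D: "disc_edges (cycle_edges (x # y # P @ [v])) =
      insert {v, x} (insert {v, b} (disc_edges (cycle_edges (x # y # P @ us)) \<union> (\<lambda>u. {v, u}) ` set us))"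
    and M: "nice_tails s x y (P @ us) M"
  shows "\<exists>N. nice_tails s x y (P @ [v]) N"
proof -
  define D' R' where "D' = disc_edges (cycle_edges (x # y # P @ us))"
    and "R' = region (cycle_edges (x # y # P @ us))"
  define U where "U = mset_set (set us)"
  have dist: "distinct (x # y # P @ [v])" and dist': "distinct (x # y # P @ us)"
    using L L' by (simp_all add: is_cycle_def)
  have "b \<in> set (y # P)" unfolding b[symmetric] by (rule last_in_set) simp
  then have bx: "x \<noteq> b" "b \<noteq> v" "b \<notin> set us" using dist dist' by auto
  have xv: "x \<noteq> v" "y \<noteq> v" "x \<notin> set us" "y \<notin> set us" using dist dist' by auto
  have vR: "v \<notin> V \<inter> region (cycle_edges (x # y # P @ [v]))"
    using cycle_avoids_region[OF L] by simp
  then have vus: "v \<notin> set us" unfolding R by simp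
  have vR': "v \<notin> V \<inter> R'" using vR unfolding R R'_def by simp
  have M': "orient_coeff s (D' - {{x, y}}) M \<noteq> 0" "count M x = 0" "count M y = 0"
    "\<forall>z\<in>set (P @ us). count M z \<le> 2" "\<forall>z\<in>V \<inter> R'. count M z \<le> 4"
    using M by (simp_all add: nice_tails_def D'_def R'_def)
  have vE: "v \<notin> \<Union>(D' - {{x, y}})" using v unfolding D'_def by blast
  have vM: "count M v = 0"
    using orient_coeff_nonzero(2)[OF M'(1)] vE by (auto simp: count_eq_zero_iff)
  have cU: "count U z = (if z \<in> set us then 1 else 0)" for z by (simp add: U_def count_mset_set')
  have edges: "disc_edges (cycle_edges (x # y # P @ [v])) - {{x, y}} =
      insert {v, x} (insert {v, b} ((D' - {{x, y}}) \<union> (\<lambda>u. {v, u}) ` set us))"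
  proof -
    have "{v, u} \<noteq> {x, y}" for u using xv by (auto simp: doubleton_eq_iff)
    then show ?thesis unfolding D D'_def[symmetric] by auto
  qed
  \<comment> \<open>Both outcomes of \<open>orient_coeff_add_vertex\<close> are treated at once:
    \<open>t = v\<close> is \<open>double\<close>, and \<open>t \<in> set us\<close> is
    \<open>single\<close>. As \<open>b\<close> is not in \<open>us\<close>, its exponent does not
    grow.\<close>
  have nice: "nice_tails s x y (P @ [v]) N"
    if "orient_coeff s (insert {v, x} (insert {v, b} ((D' - {{x, y}}) \<union> (\<lambda>u. {v, u}) ` set us))) N \<noteq> 0"
      and N: "N = add_mset v (add_mset t (M + U))" and t: "t = v \<or> t \<in> set us" for N t
  proof -
    have "count N x = 0" "count N y = 0" using N t xv M' cU by auto
    moreover have "count N z \<le> 2" if z: "z \<in> set (P @ [v])" for z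
    proof (cases "z = v")
      case True
      then show ?thesis using N t vM vus cU by auto
    next
      case False
      then have "z \<in> set P" using z by simp
      then have "z \<notin> set us" using dist' by auto
      then show ?thesis using N t cU M'(4) \<open>z \<in> set P\<close> False by auto
    qed
    moreover have "count N z \<le> 4" if z: "z \<in> V \<inter> region (cycle_edges (x # y # P @ [v]))" for z
    proof (cases "z \<in> set us")
      case True
      then have "count M z \<le> 2" using M'(4) by simp
      moreover have "z \<noteq> v" using True vus by auto
      ultimately show ?thesis using N cU by simp
    next
      case False
      then have "z \<in> V \<inter> R'" using z unfolding R R'_def by simp
      then have "z \<noteq> v" "count M z \<le> 4" using vR' M'(5) by auto
      then show ?thesis using N t False cU by auto
    qed
    ultimately show ?thesis using that(1) by (simp add: nice_tails_def edges)
  qed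
  have fin: "finite (D' - {{x, y}})" using finite_disc_edges by (simp add: D'_def)
  have "x \<notin># M" using M'(2) by (simp add: count_eq_zero_iff)
  from orient_coeff_add_vertex[of "set us" v "D' - {{x, y}}" s M x b,
      OF finite_set vus fin vE M'(1) xv(3) bx(3,1) xv(1) bx(2) this nz, folded U_def]
  show ?thesis using nice by metis
qed

end

context near_triangulation
begin

text \<open>The root edge has to vary in the induction, because a chord becomes the root of one of
  the two discs that it separates. The weights \<open>s\<close> stay fixed; only their being nonzero
  is used.\<close>

lemma exists_nice_tails:
  assumes "is_cycle E (x # y # P)" and nz: "\<And>e z. s e z \<noteq> 0"
  shows "\<exists>M. nice_tails s x y P M"
  using assms(1)
proof (induction "card (disc_edges (cycle_edges (x # y # P)))" arbitrary: x y P rule: less_induct)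
  case (less x y P)
  define v P0 where "v = last P" and "P0 = butlast P"
  have "P \<noteq> []" using less.prems by (auto simp: is_cycle_def)
  then have P: "P = P0 @ [v]" by (simp add: v_def P0_def)
  note L = less.prems[unfolded P]
  define b where "b = last (y # P0)"
  have dist: "distinct (x # y # P0 @ [v])" using L by (simp add: is_cycle_def)
  show ?case
  \<comment> \<open>The neighbours of \<open>v\<close> on the cycle are \<open>b\<close> and
    \<open>x\<close>; the former is excluded explicitly, the latter is not in the list.\<close>
  proof (cases "\<exists>w\<in>set (y # P0). w \<noteq> b \<and> {v, w} \<in> disc_edges (cycle_edges (x # y # P0 @ [v]))")
    case True
    then obtain w where w: "w \<in> set (y # P0)" "w \<noteq> b"
      "{v, w} \<in> disc_edges (cycle_edges (x # y # P0 @ [v]))" by blast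
    obtain A B where AB: "y # P0 = A @ w # B" using split_list[OF w(1)] by blast
    have "B \<noteq> []"
    proof
      assume "B = []"
      then show False using w(2) AB by (simp add: b_def)
    qed
    define P1 where "P1 = tl (A @ [w])"
    have P1: "y # P1 = A @ [w]" "P0 = P1 @ B"
      using AB by (cases A; simp add: P1_def)+
    have lw: "last (y # P1) = w" unfolding P1(1) by simp
    have Lq: "x # y # P0 @ [v] = x # y # P1 @ B @ [v]" using P1(2) by simp
    note L = L[unfolded Lq] and vw = w(3)[unfolded Lq]
    note cut = cut_at_chord[OF L lw \<open>B \<noteq> []\<close> vw]
    have boundary: "cycle_edges K \<subseteq> disc_edges (cycle_edges K)" if "is_cycle E K" for K
      using that boundary_subset_disc_edges by (simp add: is_cycle_def)
    have xy: "{x, y} \<in> disc_edges (cycle_edges (x # y # P1 @ [v]))" "{x, y} \<in> cycle_edges (x # y # P1 @ B @ [v])"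
      using boundary[OF cut(2)] by (auto simp: cycle_edges_Cons)
    obtain z B0 where B: "B = z # B0" using \<open>B \<noteq> []\<close> by (cases B) auto
    have wz: "{w, z} \<in> disc_edges (cycle_edges (v # w # B))"
      using boundary[OF cut(3)] B by (auto simp: cycle_edges_Cons)
    have "distinct (v # w # B)" using cut(3) by (simp add: is_cycle_def)
    then have wz_new: "{w, z} \<noteq> {v, w}" using B by (auto simp: doubleton_eq_iff)
    have xy_new: "{x, y} \<noteq> {v, w}" using xy(2) cut(1) by metis
    \<comment> \<open>Each disc lacks an edge of the other, \<open>{w, z}\<close> in the first and
      \<open>{x, y}\<close> in the second, so both are strictly smaller than the whole.\<close>
    have "{w, z} \<notin> disc_edges (cycle_edges (x # y # P1 @ [v]))"
    proof
      assume "{w, z} \<in> disc_edges (cycle_edges (x # y # P1 @ [v]))"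
      then have "{w, z} \<in> {{v, w}}" using wz unfolding cut(5)[symmetric] by (rule IntI)
      then show False using wz_new by simp
    qed
    then have less1: "card (disc_edges (cycle_edges (x # y # P1 @ [v]))) < card (disc_edges (cycle_edges (x # y # P)))"
      unfolding P Lq cut(4) using wz finite_disc_edges by (intro psubset_card_mono) auto
    have "{x, y} \<notin> disc_edges (cycle_edges (v # w # B))"
    proof
      assume "{x, y} \<in> disc_edges (cycle_edges (v # w # B))"
      with xy(1) have "{x, y} \<in> {{v, w}}" unfolding cut(5)[symmetric] by (rule IntI)
      then show False using xy_new by simp
    qed
    then have less2: "card (disc_edges (cycle_edges (v # w # B))) < card (disc_edges (cycle_edges (x # y # P)))"
      unfolding P Lq cut(4) using xy(1) finite_disc_edges by (intro psubset_card_mono) auto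
    obtain M1 where M1: "nice_tails s x y (P1 @ [v]) M1" using less.hyps[OF less1 cut(2)] by blast
    obtain M2 where M2: "nice_tails s v w B M2" using less.hyps[OF less2 cut(3)] by blast
    have "P = P1 @ B @ [v]" using P P1(2) by simp
    then show ?thesis using nice_tails_glue[OF L lw \<open>B \<noteq> []\<close> vw M1 M2] by blast
  next
    case False
    have fan: "(y # P0 = [b] \<and> disc_edges (cycle_edges (x # y # P0 @ [v])) = {{x, b}, {v, x}, {v, b}} \<and>
        V \<inter> region (cycle_edges (x # y # P0 @ [v])) = {}) \<or>
      (\<exists>us. is_cycle E (x # y # P0 @ us) \<and>
        V \<inter> region (cycle_edges (x # y # P0 @ [v])) = (V \<inter> region (cycle_edges (x # y # P0 @ us))) \<union> set us \<and>
        v \<notin> \<Union>(disc_edges (cycle_edges (x # y # P0 @ us))) \<and>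
        disc_edges (cycle_edges (x # y # P0 @ [v])) =
          insert {v, x} (insert {v, b} (disc_edges (cycle_edges (x # y # P0 @ us)) \<union> (\<lambda>u. {v, u}) ` set us)))"
    proof (rule remove_chordless_vertex[of x "y # P0" v b, unfolded append_Cons])
      show "last (x # y # P0) = b" by (simp add: b_def)
      show "w = b" if "w \<in> set (y # P0)" "{v, w} \<in> disc_edges (cycle_edges (x # y # P0 @ [v]))" for w
        using False that by blast
    qed (rule L)
    show ?thesis
    proof (rule disjE[OF fan])
      assume tri: "y # P0 = [b] \<and> disc_edges (cycle_edges (x # y # P0 @ [v])) = {{x, b}, {v, x}, {v, b}} \<and>
        V \<inter> region (cycle_edges (x # y # P0 @ [v])) = {}"
      then have y: "y = b" "P0 = []" by simp_all
      have D: "disc_edges (cycle_edges (x # y # P0 @ [v])) = {{x, b}, {v, x}, {v, b}}"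
        and R: "V \<inter> region (cycle_edges (x # y # P0 @ [v])) = {}"
        using tri by blast+
      have ne: "x \<noteq> v" "b \<noteq> v" "x \<noteq> b" using dist y by auto
      have "{{x, b}, {v, x}, {v, b}} - {{x, b}} = insert {v, x} (insert {v, b} {})"
        using ne by (auto simp: doubleton_eq_iff)
      \<comment> \<open>The triangle: with tail \<open>v\<close> at both remaining edges,
        \<open>x\<close> and \<open>b\<close> are sinks, and no other tail choice gives this
        monomial.\<close>
      moreover have "orient_coeff s (insert {v, x} (insert {v, b} {})) {#v, v#} \<noteq> 0"
        using ne nz by (subst orient_coeff_insert_doubleton)
          (auto simp: orient_coeff_insert_doubleton orient_coeff_empty doubleton_eq_iff)
      ultimately have "orient_coeff s (disc_edges (cycle_edges (x # y # P0 @ [v])) - {{x, y}}) {#v, v#} \<noteq> 0"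
        unfolding D unfolding y(1) by (simp only: not_False_eq_True)
      then have "nice_tails s x y (P0 @ [v]) {#v, v#}"
        unfolding nice_tails_def R using y ne by simp
      then show ?thesis unfolding P by blast
    next
      assume "\<exists>us. is_cycle E (x # y # P0 @ us) \<and>
        V \<inter> region (cycle_edges (x # y # P0 @ [v])) = (V \<inter> region (cycle_edges (x # y # P0 @ us))) \<union> set us \<and>
        v \<notin> \<Union>(disc_edges (cycle_edges (x # y # P0 @ us))) \<and>
        disc_edges (cycle_edges (x # y # P0 @ [v])) =
          insert {v, x} (insert {v, b} (disc_edges (cycle_edges (x # y # P0 @ us)) \<union> (\<lambda>u. {v, u}) ` set us))"
      then obtain us where us: "is_cycle E (x # y # P0 @ us)"
        "V \<inter> region (cycle_edges (x # y # P0 @ [v])) = (V \<inter> region (cycle_edges (x # y # P0 @ us))) \<union> set us"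
        "v \<notin> \<Union>(disc_edges (cycle_edges (x # y # P0 @ us)))"
        "disc_edges (cycle_edges (x # y # P0 @ [v])) =
          insert {v, x} (insert {v, b} (disc_edges (cycle_edges (x # y # P0 @ us)) \<union> (\<lambda>u. {v, u}) ` set us))"
        by (elim exE conjE)
      have "{v, x} \<notin> disc_edges (cycle_edges (x # y # P0 @ us))" using us(3) by blast
      then have "card (disc_edges (cycle_edges (x # y # P0 @ us))) < card (disc_edges (cycle_edges (x # y # P)))"
        unfolding P us(4) by (intro psubset_card_mono) (auto simp: finite_disc_edges)
      then obtain M where M: "nice_tails s x y (P0 @ us) M" using less.hyps us(1) by blast
      show ?thesis
        unfolding P by (rule nice_tails_add_vertex[OF L us(1) nz b_def[symmetric] us(2-4) M])
    qed
  qed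
qed

end

theorem theorem3p2:
  fixes V :: "complex set" and E :: "complex set set"
    and \<gamma> :: "complex set \<Rightarrow> real \<Rightarrow> complex"
    and \<sigma> :: "complex set \<Rightarrow> int" and C :: "complex list"
  assumes "signed_graph V E \<sigma>"
    and "near_triangulation V E \<gamma> C"
  shows "\<exists>D. orientation_of D V (E - {{C ! 0, C ! 1}}) \<and> sigma_nice V \<sigma> C D"
proof -
  interpret near_triangulation V E \<gamma> C by (rule assms(2))
  note outer = outer_cycle_disc
  have "distinct C" "3 \<le> length C" using outer(1) by (auto simp: is_cycle_def)
  then obtain x y P where C: "C = x # y # P" by (metis Suc_le_length_iff numeral_3_eq_3)
  have "is_cycle E (x # y # P)" using outer(1) C by simp
  from exists_nice_tails[OF this tail_sign_nonzero]
  obtain M where "nice_tails (tail_sign \<sigma>) x y P M" ..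
  then have M: "orient_coeff (tail_sign \<sigma>) (E - {{x, y}}) M \<noteq> 0"
    "count M x = 0" "count M y = 0" "\<forall>z\<in>set P. count M z \<le> 2"
    "\<forall>z\<in>V \<inter> region (cycle_edges C). count M z \<le> 4"
    unfolding nice_tails_def C[symmetric] outer(2) by simp_all
  \<comment> \<open>The passage from coefficients to orientations needs only a simple graph, so it
    can be applied to the graph without its root edge.\<close>
  interpret G: simple_graph V "E - {{x, y}}"
    using finite_vertices edge_subset edge_card by unfold_locales auto
  obtain D where D: "orientation_of D V (E - {{x, y}})" "card (sigma_EE \<sigma> D) \<noteq> card (sigma_OE \<sigma> D)"
    "\<forall>v. out_degree (with_proj D) v = count M v"
    by (rule G.exists_orientation[OF M(1)])
  \<comment> \<open>List positions start at 0, so \<open>i - 1\<close> is at least 2 and skips the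
    two root vertices.\<close>
  have "C ! (i - 1) \<in> set P" if "i \<in> {3..length C}" for i :: nat
  proof -
    obtain j where "i = 3 + j" using \<open>i \<in> {3..length C}\<close> by (auto simp: le_iff_add)
    then have "i - 1 = Suc (Suc j)" "j < length P" using \<open>i \<in> {3..length C}\<close> C by auto
    then show ?thesis by (simp add: C)
  qed
  then have "sigma_nice V \<sigma> C D"
    unfolding sigma_nice_def D(3)[rule_format] using D(2) M outer(3) C by auto
  then show ?thesis using D(1) C by auto
qed

end
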